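(* Fix a constant $K\ge 1$. There is a polynomial-time algorithm that, given two MSyDSs $\mathcal{S}_0$ and $\mathcal{S}_1$ on a common node set $V$, each having at most $K$ layers, in which every local function is a symmetric Boolean function and every master function is an arbitrary Boolean function, decides whether $\mathcal{S}_0$ and $\mathcal{S}_1$ are equivalent.
   Context: A multilayer synchronous dynamical system (MSyDS) $\mathcal{S}$ over $\mathbb{B}=\{0,1\}$ with $k\ge 1$ layers consists of: a finite node set $V$; undirected simple graphs $G_i=(V,E_i)$, $1\le i\le k$ (all layers share the node set $V$); for each layer $i$ and node $v$ a local function $f_{i,v}$ with output in $\mathbb{B}$ whose inputs are the states of the nodes in the closed neighborhood of $v$ in $G_i$ ($v$ and its neighbors in $G_i$); and for each node $v$ a master function $\psi_v:\mathbb{B}^k\to\mathbb{B}$. A configuration is a map $\mathcal{C}:V\to\mathbb{B}$; its successor is $\mathcal{C}'$ with $\mathcal{C}'(v)=\psi_v(f_{1,v}(\mathcal{C}),\dots,f_{k,v}(\mathcal{C}))$ for all $v$ (synchronous update), where $f_{i,v}(\mathcal{C})$ is $f_{i,v}$ evaluated on the states in $\mathcal{C}$ of the closed neighborhood of $v$ in $G_i$. The phase space is the directed graph on all configurations with an arc from each configuration to its successor. Two MSyDSs on the same node set are equivalent if their phase spaces are identical. A Boolean function is symmetric if its value depends only on the number of 1's among its inputs; a symmetric function with $q$ inputs is specified by its symmetry table, listing for each $j\in\{0,\dots,q\}$ the value when exactly $j$ inputs are 1. The input consists of the graphs (edge lists), the symmetry tables of the local functions, and the master functions (e.g., as truth tables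 on at most $K$ inputs); polynomial time is measured in the size of this input (in particular in $|V|$). *)

theory Defs
  imports Main
begin

text \<open>An MSyDS on node set V = {0..<n} is given, as in the paper's input format, by
  (E, T, P):
  E ! i  : edge list of layer G_(i+1)   (k = length E layers),
  T ! i ! v : symmetry table of the local function f_(i+1),v
              (entry j = value when exactly j inputs of the closed neighbourhood are 1),
  P ! v  : truth table of the master function psi_v : B^k -> B,
           entry (sum_(i<k) b_(i+1) * 2^i) = psi_v(b_1,...,b_k).\<close>

type_synonym msyds = "(nat \<times> nat) list list \<times> bool list list list \<times> bool list list"

definition layers :: "msyds \<Rightarrow> (nat \<times> nat) list list" where
  "layers S = fst S"
definition symtabs :: "msyds \<Rightarrow> bool list list list" where
  "symtabs S = fst (snd S)"
definition masters :: "msyds \<Rightarrow> bool list list" where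
  "masters S = snd (snd S)"

definition nbrs :: "(nat \<times> nat) list \<Rightarrow> nat \<Rightarrow> nat set" where
  "nbrs es v = {u. (u, v) \<in> set es \<or> (v, u) \<in> set es}"

definition closed_nbhd :: "(nat \<times> nat) list \<Rightarrow> nat \<Rightarrow> nat set" where
  "closed_nbhd es v = insert v (nbrs es v)"

definition valid_msyds :: "nat \<Rightarrow> nat \<Rightarrow> msyds \<Rightarrow> bool" where
  "valid_msyds n K S \<longleftrightarrow>
     (let k = length (layers S) in
       1 \<le> k \<and> k \<le> K \<and>
       (\<forall>es \<in> set (layers S). \<forall>(u, v) \<in> set es. u < n \<and> v < n \<and> u \<noteq> v) \<and>
       length (symtabs S) = k \<and>
       (\<forall>i < k. length (symtabs S ! i) = n \<and>
          (\<forall>v < n. length (symtabs S ! i ! v) = card (closed_nbhd (layers S ! i) v) + 1)) \<and>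
       length (masters S) = n \<and>
       (\<forall>v < n. length (masters S ! v) = 2 ^ k))"

definition configs :: "nat \<Rightarrow> (nat \<Rightarrow> bool) set" where
  "configs n = {C. \<forall>v. n \<le> v \<longrightarrow> C v = False}"

definition local_val :: "msyds \<Rightarrow> nat \<Rightarrow> nat \<Rightarrow> (nat \<Rightarrow> bool) \<Rightarrow> bool" where
  "local_val S i v C = symtabs S ! i ! v ! card {u \<in> closed_nbhd (layers S ! i) v. C u}"

text \<open>Master function psi_v applied to the vector (b_1,...,b_k) given as b (i) = b_(i+1).\<close>
definition master_val :: "msyds \<Rightarrow> nat \<Rightarrow> (nat \<Rightarrow> bool) \<Rightarrow> bool" where
  "master_val S v b = masters S ! v ! (\<Sum>i < length (layers S). if b i then 2 ^ i else 0)"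

definition successor :: "nat \<Rightarrow> msyds \<Rightarrow> (nat \<Rightarrow> bool) \<Rightarrow> (nat \<Rightarrow> bool)" where
  "successor n S C = (\<lambda>v. if v < n then master_val S v (\<lambda>i. local_val S i v C) else False)"

definition phase_space :: "nat \<Rightarrow> msyds \<Rightarrow> ((nat \<Rightarrow> bool) \<times> (nat \<Rightarrow> bool)) set" where
  "phase_space n S = {(C, successor n S C) | C. C \<in> configs n}"

definition equivalent :: "nat \<Rightarrow> msyds \<Rightarrow> msyds \<Rightarrow> bool" where
  "equivalent n S0 S1 \<longleftrightarrow> phase_space n S0 = phase_space n S1"

text \<open>Inputs are strings over the 5-letter alphabet  0 = '0', 1 = '1', 2 = '(', 3 = ')',
  4 = ','.  Natural numbers (node names, n) are written in unary; sequences are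
  parenthesised and comma-terminated.  This is polynomially related to any standard
  encoding of the instance (node names are < n and the input contains n symmetry tables).\<close>

definition enc_seq :: "nat list list \<Rightarrow> nat list" where
  "enc_seq xs = [2] @ concat (map (\<lambda>x. x @ [4]) xs) @ [3]"

definition enc_nat :: "nat \<Rightarrow> nat list" where
  "enc_nat m = replicate m 1"

definition enc_bools :: "bool list \<Rightarrow> nat list" where
  "enc_bools bs = enc_seq (map (\<lambda>b. [if b then 1 else 0]) bs)"

definition enc_edge :: "nat \<times> nat \<Rightarrow> nat list" where
  "enc_edge e = enc_seq [enc_nat (fst e), enc_nat (snd e)]"

definition enc_msyds :: "msyds \<Rightarrow> nat list" where
  "enc_msyds S = enc_seq
     [enc_seq (map (\<lambda>es. enc_seq (map enc_edge es)) (layers S)),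
      enc_seq (map (\<lambda>tv. enc_seq (map enc_bools tv)) (symtabs S)),
      enc_seq (map enc_bools (masters S))]"

definition enc_instance :: "nat \<Rightarrow> msyds \<Rightarrow> msyds \<Rightarrow> nat list" where
  "enc_instance n S0 S1 = enc_seq [enc_nat n, enc_msyds S0, enc_msyds S1]"

text \<open>A machine (Q, G, delta): states {0..<Q} (0 start, 1 accept, 2 reject),
  tape symbols {0..<G} (0 blank, c+1 encodes input letter c), delta q s = (q', s', move),
  move in {-1,0,1}.\<close>

type_synonym tm = "nat \<times> nat \<times> (nat \<Rightarrow> nat \<Rightarrow> nat \<times> nat \<times> int)"

definition tm_wf :: "tm \<Rightarrow> bool" where
  "tm_wf M \<longleftrightarrow> (case M of (Q, G, \<delta>) \<Rightarrow>
     3 \<le> Q \<and> 6 \<le> G \<and>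
     (\<forall>q < Q. \<forall>s < G. fst (\<delta> q s) < Q \<and> fst (snd (\<delta> q s)) < G \<and>
                      snd (snd (\<delta> q s)) \<in> {-1, 0, 1}))"

type_synonym tm_config = "nat \<times> (int \<Rightarrow> nat) \<times> int"

definition tm_step :: "tm \<Rightarrow> tm_config \<Rightarrow> tm_config" where
  "tm_step M c = (case c of (q, tp, h) \<Rightarrow>
     if q = 1 \<or> q = 2 then c
     else (case (snd (snd M)) q (tp h) of (q', s', m) \<Rightarrow> (q', tp(h := s'), h + m)))"

definition tm_init :: "nat list \<Rightarrow> tm_config" where
  "tm_init w = (0, (\<lambda>i. if 0 \<le> i \<and> i < int (length w) then w ! nat i + 1 else 0), 0)"

definition tm_run :: "tm \<Rightarrow> nat \<Rightarrow> nat list \<Rightarrow> tm_config" where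
  "tm_run M t w = (tm_step M ^^ t) (tm_init w)"

definition tm_decides_within :: "tm \<Rightarrow> nat list \<Rightarrow> bool \<Rightarrow> nat \<Rightarrow> bool" where
  "tm_decides_within M w b t \<longleftrightarrow> fst (tm_run M t w) = (if b then 1 else 2)"

end

theory Submission
  imports Defs "HOL-Library.Nat_Bijection"
begin

text \<open>The successor bit of a node v depends on a configuration only through the numbers of ones in the
  at most 2K closed neighbourhoods of v, taken in all layers of both systems.  The membership pattern
  of a node in these neighbourhoods divides the nodes into at most 4^K cells, and every configuration
  gives the same counts as one in which, inside each cell A, exactly the nodes below a threshold
  \<theta> A are one.  Hence the systems are equivalent iff the outputs agree for all v and all
  \<theta> with values at most n: a constant number of quantifiers over numbers bounded by the input length.

  This condition is a sentence of first-order logic with counting over the input word.  Such a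
  sentence with r nested quantifiers is decided by a Turing machine that keeps each variable and each
  counter as a mark on a tape cell, and tries all values one after another, so that the running time
  is polynomial of a degree depending on r only.\<close>

section \<open>Structured programs for one tape\<close>

text \<open>Symmetry of the local functions is what makes thresholds suffice: a cell matters only
  through its number of ones, so the ones may be moved to its smallest nodes. A threshold on node
  names is handier than a number of ones per cell, because membership becomes one comparison of
  variables and a single count per neighbourhood adds over all its cells. Going through logic avoids
  programming a one-tape machine for this particular problem: parsing and evaluation are both
  written as formulas, and only one evaluator has to be verified. Counting serves twice, for the
  numbers of ones and for the bracket structure of the input, which is recognised by comparing
  numbers of opening and closing brackets. The quantified values fit into the word as positions
  because n itself is written there in unary. The machine is fixed before the instance, so the
  sentence may depend on K alone; layers that an instance lacks must therefore read as harmless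
  defaults.\<close>

datatype 'a prog =
    Accept | Reject | Skip
  | Act "'a \<Rightarrow> 'a" int
  | Seq "'a prog" "'a prog"
  | Cond "'a \<Rightarrow> bool" "'a prog" "'a prog"
  | While "'a \<Rightarrow> bool" "'a prog"

text \<open>A step reads and writes only the scanned cell, as a machine does. A verdict inside
  \<open>Seq\<close> stays there forever, so it is recognised only when it is the whole remaining
  program; compiled code keeps verdicts in tail position.\<close>

primrec pstep :: "'a prog \<Rightarrow> 'a \<Rightarrow> 'a prog \<times> 'a \<times> int" where
  "pstep Accept s = (Accept, s, 0)"
| "pstep Reject s = (Reject, s, 0)"
| "pstep Skip s = (Skip, s, 0)"
| "pstep (Act f m) s = (Skip, f s, m)"
| "pstep (Seq p q) s =
    (if p = Skip then (q, s, 0) else (case pstep p s of (p', s', m) \<Rightarrow> (Seq p' q, s', m)))"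
| "pstep (Cond b p q) s = (if b s then p else q, s, 0)"
| "pstep (While b p) s = (if b s then Seq p (While b p) else Skip, s, 0)"

type_synonym 'a pconfig = "'a prog \<times> (int \<Rightarrow> 'a) \<times> int"

fun cstep :: "'a pconfig \<Rightarrow> 'a pconfig" where
  "cstep (p, T, h) = (case pstep p (T h) of (p', s, m) \<Rightarrow> (p', T(h := s), h + m))"

text \<open>An upper bound instead of an exact number of steps lets branches of different lengths
  share one estimate.\<close>

definition reach :: "nat \<Rightarrow> 'a pconfig \<Rightarrow> 'a pconfig \<Rightarrow> bool" where
  "reach t c c' \<longleftrightarrow> (\<exists>k\<le>t. (cstep ^^ k) c = c')"

lemma reach_refl: "reach t c c"
  unfolding reach_def by (rule exI[of _ 0]) simp

lemma reach_mono: "reach s c c' \<Longrightarrow> s \<le> t \<Longrightarrow> reach t c c'"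
  unfolding reach_def by (elim exE conjE, rule exI, rule conjI, erule (1) le_trans)

lemma reach_trans: "reach s c c' \<Longrightarrow> reach t c' c'' \<Longrightarrow> reach (s + t) c c''"
proof -
  assume "reach s c c'" "reach t c' c''"
  then obtain k l where "k \<le> s" "l \<le> t" "(cstep ^^ k) c = c'" "(cstep ^^ l) c' = c''"
    unfolding reach_def by blast
  then show ?thesis unfolding reach_def
    by (intro exI[of _ "k + l"]) (simp add: add.commute[of k] funpow_add)
qed

lemma reach_trans_le:
  "reach s c c' \<Longrightarrow> reach t c' c'' \<Longrightarrow> s + t \<le> u \<Longrightarrow> reach u c c''"
  by (rule reach_mono[OF reach_trans])

lemma reach_step: "cstep c = c' \<Longrightarrow> reach 1 c c'"
  unfolding reach_def by (rule exI[of _ 1]) simp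

lemma cstep_Skip_iterate: "(cstep ^^ k) (Skip, T, h) = (Skip, T, h)"
  by (induction k) auto

lemma reach_Seq:
  assumes "reach t (p, T, h) (Skip, T', h')"
  shows "reach (t + 1) (Seq p q, T, h) (q, T', h')"
proof -
  obtain k where "k \<le> t" "(cstep ^^ k) (p, T, h) = (Skip, T', h')"
    using assms unfolding reach_def by blast
  then show ?thesis
  proof (induction k arbitrary: t p T h)
    case 0
    then show ?case by (intro reach_mono[OF reach_step]) auto
  next
    case (Suc k)
    show ?case
    proof (cases "p = Skip")
      case True
      \<comment> \<open>\<open>Skip\<close> is a fixed point, so the remaining steps changed
        nothing.\<close>
      with Suc.prems have "T' = T" "h' = h" using cstep_Skip_iterate[of "Suc k" T h] by simp_all
      with True show ?thesis by (intro reach_mono[OF reach_step]) auto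
    next
      case False
      obtain p' T1 h1 where s: "cstep (p, T, h) = (p', T1, h1)" by (metis prod_cases3)
      have "cstep (Seq p q, T, h) = (Seq p' q, T1, h1)"
        using s False by (auto split: prod.splits)
      moreover have "reach (t - 1 + 1) (Seq p' q, T1, h1) (q, T', h')"
        using Suc.prems s by (intro Suc.IH) (auto simp del: cstep.simps funpow.simps simp add: funpow_Suc_right)
      ultimately have "reach (1 + (t - 1 + 1)) (Seq p q, T, h) (q, T', h')"
        by (intro reach_trans[OF reach_step])
      then show ?thesis using Suc.prems(1) by simp
    qed
  qed
qed

lemma reach_Seq_le:
  assumes "reach s (p, T, h) (Skip, T', h')" "reach t (q, T', h') c" "s + t + 1 \<le> u"
  shows "reach u (Seq p q, T, h) c"
  using reach_trans_le[OF reach_Seq[OF assms(1)] assms(2)] assms(3) by simp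

lemma reach_Act: "T' = T(h := f (T h)) \<Longrightarrow> h' = h + m \<Longrightarrow> reach 1 (Act f m, T, h) (Skip, T', h')"
  by (rule reach_step) simp

lemma reach_Cond: "reach 1 (Cond b p q, T, h) (if b (T h) then p else q, T, h)"
  by (rule reach_step) simp

lemma reach_While_exit: "\<not> b (T h) \<Longrightarrow> reach 1 (While b p, T, h) (Skip, T, h)"
  by (rule reach_step) simp

lemma reach_While_iter:
  assumes "b (T h)" "reach s (p, T, h) (Skip, T', h')" "reach t (While b p, T', h') c" "s + t + 2 \<le> u"
  shows "reach u (While b p, T, h) c"
proof -
  have "reach 1 (While b p, T, h) (Seq p (While b p), T, h)"
    using assms(1) by (intro reach_step) simp
  moreover have "reach (s + t + 1) (Seq p (While b p), T, h) c"
    using assms(2,3) by (rule reach_Seq_le) simp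
  ultimately show ?thesis using assms(4) by (rule_tac reach_trans_le) auto
qed

section \<open>Finitely many remaining programs\<close>

primrec residuals :: "'a prog \<Rightarrow> 'a prog set" where
  "residuals Accept = {Accept}"
| "residuals Reject = {Reject}"
| "residuals Skip = {Skip}"
| "residuals (Act f m) = {Act f m, Skip}"
| "residuals (Seq p q) = (\<lambda>p'. Seq p' q) ` residuals p \<union> residuals q"
| "residuals (Cond b p q) = {Cond b p q} \<union> residuals p \<union> residuals q"
| "residuals (While b p) = {While b p, Skip} \<union> (\<lambda>p'. Seq p' (While b p)) ` residuals p"

lemma finite_residuals: "finite (residuals p)"
  by (induction p) auto

lemma self_in_residuals: "p \<in> residuals p"
  by (induction p) auto

text \<open>Unfolding a loop gives \<open>Seq p (While b p)\<close>, whose later forms differ only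
  in the first component. Loops therefore do not pile up, and the residuals can serve as states,
  like the partial derivatives of a regular expression.\<close>

lemma residuals_closed: "p' \<in> residuals p \<Longrightarrow> fst (pstep p' s) \<in> residuals p"
proof (induction p arbitrary: p')
  case (Seq p q)
  show ?case
  proof (cases "p' \<in> residuals q")
    case False
    then obtain r where r: "p' = Seq r q" "r \<in> residuals p" using Seq.prems by auto
    show ?thesis
      using Seq.IH(1)[OF r(2)] r by (cases "pstep r s") (auto simp: self_in_residuals)
  qed (use Seq.IH(2) in auto)
next
  case (While b p)
  show ?case
  proof (cases "p' = While b p \<or> p' = Skip")
    case False
    then obtain r where r: "p' = Seq r (While b p)" "r \<in> residuals p" using While.prems by auto
    show ?thesis
      using While.IH[OF r(2)] r by (cases "pstep r s") auto
  qed (auto simp: self_in_residuals)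
qed (auto simp: self_in_residuals)

definition preserves :: "'a set \<Rightarrow> ('a \<Rightarrow> 'a) \<Rightarrow> bool" where
  "preserves S f \<longleftrightarrow> (\<forall>s\<in>S. f s \<in> S)"

primrec acts_within :: "'a set \<Rightarrow> 'a prog \<Rightarrow> bool" where
  "acts_within S Accept = True"
| "acts_within S Reject = True"
| "acts_within S Skip = True"
| "acts_within S (Act f m) = (preserves S f \<and> m \<in> {-1, 0, 1})"
| "acts_within S (Seq p q) = (acts_within S p \<and> acts_within S q)"
| "acts_within S (Cond b p q) = (acts_within S p \<and> acts_within S q)"
| "acts_within S (While b p) = acts_within S p"

lemma acts_within_residuals: "acts_within S p \<Longrightarrow> \<forall>p'\<in>residuals p. acts_within S p'"
proof (induction p)
  case (Seq p q)
  from Seq.prems have "acts_within S p" "acts_within S q" by simp_all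
  from this Seq.IH(1)[OF this(1)] Seq.IH(2)[OF this(2)] show ?case by auto
next
  case (Cond b p q)
  from Cond.prems have "acts_within S p" "acts_within S q" by simp_all
  from this Cond.IH(1)[OF this(1)] Cond.IH(2)[OF this(2)] show ?case by auto
next
  case (While b p)
  from While.prems have "acts_within S p" by simp
  from this While.IH[OF this] show ?case by auto
qed simp_all

lemma acts_within_pstep:
  assumes "acts_within S p" "s \<in> S" "pstep p s = (p', s', m)"
  shows "s' \<in> S \<and> (m = -1 \<or> m = 0 \<or> m = 1)"
  using assms
proof (induction p arbitrary: p' s' m)
  case (Act f d)
  then have "preserves S f" "s' = f s" "m = d" "d = -1 \<or> d = 0 \<or> d = 1" by simp_all
  with Act.prems(2) show ?case unfolding preserves_def by simp
next
  case (Seq p q)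
  show ?case
  proof (cases "p = Skip")
    case True
    with Seq.prems show ?thesis by simp
  next
    case False
    obtain p1 s1 m1 where st: "pstep p s = (p1, s1, m1)" by (metis prod_cases3)
    have "s1 \<in> S \<and> (m1 = -1 \<or> m1 = 0 \<or> m1 = 1)"
      using Seq.prems(1) by (intro Seq.IH(1)[OF _ Seq.prems(2) st]) simp
    with Seq.prems(3) st False show ?thesis by simp
  qed
next
  case (Cond b p q)
  from Cond.prems(2,3) show ?case by simp
next
  case (While b p)
  from While.prems(2,3) show ?case by simp
qed simp_all

text \<open>The machine model prescribes the numbers 0, 1, 2 for start, accept and reject, so the
  other states are numbered from 3 on.\<close>

lemma enumerate_three_first:
  assumes "finite S" "a \<in> S" "b \<in> S" "c \<in> S" "a \<noteq> b" "a \<noteq> c" "b \<noteq> c"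
  obtains f :: "'a \<Rightarrow> nat" and Q where "bij_betw f S {0..<Q}" "3 \<le> Q" "f a = 0" "f b = 1" "f c = 2"
proof -
  define R where "R = S - {a, b, c}"
  obtain g where g: "bij_betw g R {0..<card R}"
    using ex_bij_betw_finite_nat[of R] assms(1) R_def by auto
  define f where "f x = (if x = a then 0 else if x = b then 1 else if x = c then 2 else g x + 3)" for x
  have "inj_on f S"
  proof (rule inj_onI)
    fix x y assume xy: "x \<in> S" "y \<in> S" "f x = f y"
    show "x = y"
    proof (cases "x \<in> R \<and> y \<in> R")
      case True
      then have "g x = g y" using xy(3) by (auto simp: f_def R_def)
      then show ?thesis using g True by (auto simp: bij_betw_def dest: inj_onD)
    next
      case False
      then show ?thesis using xy by (auto simp: f_def R_def split: if_splits)
    qed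
  qed
  moreover have "f ` S = {0..<card R + 3}"
  proof
    show "f ` S \<subseteq> {0..<card R + 3}"
    proof
      fix y assume "y \<in> f ` S"
      then obtain x where x: "x \<in> S" "y = f x" by blast
      show "y \<in> {0..<card R + 3}"
      proof (cases "x \<in> R")
        case True
        then have "g x < card R" using g bij_betwE by fastforce
        then show ?thesis using x True by (simp add: f_def R_def)
      next
        case False
        then show ?thesis using x by (auto simp: f_def R_def)
      qed
    qed
    show "{0..<card R + 3} \<subseteq> f ` S"
    proof
      fix y assume y: "y \<in> {0..<card R + 3}"
      consider "y = 0" | "y = 1" | "y = 2" | "y - 3 \<in> {0..<card R}" "y \<ge> 3"
        using y by (auto simp: numeral_eq_Suc) linarith
      then show "y \<in> f ` S"
      proof cases
        case 4
        then obtain x where "x \<in> R" "g x = y - 3" using g unfolding bij_betw_def by (metis imageE)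
        then have "x \<in> S" "f x = y" using 4 by (auto simp: R_def f_def)
        then show ?thesis by blast
      next
        case 1
        then have "y = f a" by (simp add: f_def)
        then show ?thesis using assms(2) by blast
      next
        case 2
        then have "y = f b" using assms(5) by (simp add: f_def)
        then show ?thesis using assms(3) by blast
      next
        case 3
        then have "y = f c" using assms(6,7) by (simp add: f_def)
        then show ?thesis using assms(4) by blast
      qed
    qed
  qed
  ultimately show thesis
    using assms that[of f "card R + 3"] by (auto simp: bij_betw_def f_def)
qed

section \<open>Tape symbols as numbers, programs as machines\<close>

type_synonym sym = "nat \<times> nat set"

definition syms :: "nat \<Rightarrow> sym set" where
  "syms H = {..<6} \<times> Pow {..<H}"

text \<open>A symbol without marks has its letter as code, since \<open>set_encode {} = 0\<close>;
  hence the initial tape of the machine needs no translation. The factor 6 counts five letters and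
  the blank.\<close>

fun sym_code :: "sym \<Rightarrow> nat" where
  "sym_code (l, A) = l + 6 * set_encode A"

definition sym_decode :: "nat \<Rightarrow> sym" where
  "sym_decode s = (s mod 6, set_decode (s div 6))"

lemma sum_powers_of_two_less: "(\<Sum>i<H. 2 ^ i) < (2::nat) ^ H"
  by (induction H) auto

lemma set_encode_less: "A \<subseteq> {..<H} \<Longrightarrow> set_encode A < 2 ^ H"
proof -
  assume A: "A \<subseteq> {..<H}"
  have "set_encode A \<le> (\<Sum>i<H. 2 ^ i)"
    unfolding set_encode_def using A by (intro sum_mono2) auto
  also have "\<dots> < 2 ^ H" by (rule sum_powers_of_two_less)
  finally show ?thesis .
qed

lemma set_decode_subset: "n < 2 ^ H \<Longrightarrow> set_decode n \<subseteq> {..<H}"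
proof
  fix x assume n: "n < 2 ^ H" and x: "x \<in> set_decode n"
  have "2 ^ x = set_encode {x}" by simp
  also have "\<dots> \<le> set_encode (set_decode n)"
    unfolding set_encode_def using x by (intro sum_mono2) auto
  finally have "(2::nat) ^ x \<le> n" by simp
  then have "(2::nat) ^ x < 2 ^ H" using n by (rule le_less_trans)
  then have "x < H" using power_less_imp_less_exp[of "2::nat" x H] by simp
  then show "x \<in> {..<H}" by simp
qed

lemma sym_decode_code: "s \<in> syms H \<Longrightarrow> sym_decode (sym_code s) = s"
  by (cases s) (auto simp: syms_def sym_decode_def finite_subset[of _ "{..<H}"])

lemma sym_code_less: "s \<in> syms H \<Longrightarrow> sym_code s < 6 * 2 ^ H"
  using set_encode_less[of "snd s" H] by (cases s) (auto simp: syms_def)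

lemma sym_decode_in: "s < 6 * 2 ^ H \<Longrightarrow> sym_decode s \<in> syms H"
  using set_decode_subset[of "s div 6" H] by (auto simp: syms_def sym_decode_def div_less_iff_less_mult)

definition letter_at :: "nat list \<Rightarrow> int \<Rightarrow> nat" where
  "letter_at w i = (if 0 \<le> i \<and> i < int (length w) then w ! nat i + 1 else 0)"

lemma tm_init_letter_at: "tm_init w = (0, letter_at w, 0)"
  by (auto simp: tm_init_def letter_at_def)

text \<open>Program and machine run in lockstep, so time bounds carry over unchanged. The program
  must differ from the two verdicts because start, accept and reject are distinct states.\<close>

lemma prog_to_tm:
  fixes p :: "sym prog"
  assumes "acts_within (syms H) p" "p \<noteq> Accept" "p \<noteq> Reject"
  obtains M where "tm_wf M"
    "\<And>w k b T h. set w \<subseteq> {..<5} \<Longrightarrow>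
      (cstep ^^ k) (p, \<lambda>i. (letter_at w i, {}), 0) = (if b then Accept else Reject, T, h) \<Longrightarrow>
      tm_decides_within M w b k"
proof -
  define S where "S = insert Accept (insert Reject (residuals p))"
  have closed: "fst (pstep q s) \<in> S" if "q \<in> S" for q s
    using that residuals_closed[of q p s] by (auto simp: S_def)
  have acts: "acts_within (syms H) q" if "q \<in> S" for q
    using that acts_within_residuals[OF assms(1)] assms(1) by (auto simp: S_def)
  obtain f :: "sym prog \<Rightarrow> nat" and Q where f: "bij_betw f S {0..<Q}" "3 \<le> Q" "f p = 0" "f Accept = 1" "f Reject = 2"
    using enumerate_three_first[of S p Accept Reject] assms(2,3) finite_residuals[of p]
      self_in_residuals[of p] by (metis S_def finite_insert insertCI prog.distinct(1))
  define g where "g = inv_into S f"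
  have gf: "g (f q) = q" if "q \<in> S" for q
    using f(1) that by (simp add: g_def bij_betw_def)
  have f_less: "f q < Q" if "q \<in> S" for q
    using f(1) that bij_betwE by fastforce
  have g_in: "g i \<in> S" if "i < Q" for i
    using f(1) that unfolding g_def bij_betw_def by (simp add: inv_into_into)
  define \<delta> where "\<delta> i s = (case pstep (g i) (sym_decode s) of (q, s', m) \<Rightarrow> (f q, sym_code s', m))" for i s
  define M :: tm where "M = (Q, 6 * 2 ^ H, \<delta>)"
  have "tm_wf M"
  proof -
    have "fst (\<delta> i s) < Q \<and> fst (snd (\<delta> i s)) < 6 * 2 ^ H \<and> snd (snd (\<delta> i s)) \<in> {-1, 0, 1}"
      if "i < Q" "s < 6 * 2 ^ H" for i s
    proof -
      obtain q s' m where st: "pstep (g i) (sym_decode s) = (q, s', m)" by (metis prod_cases3)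
      then show ?thesis
        using closed[OF g_in[OF that(1)], of "sym_decode s"]
          acts_within_pstep[OF acts[OF g_in[OF that(1)]] sym_decode_in[OF that(2)] st]
        by (auto simp: \<delta>_def f_less sym_code_less)
    qed
    then show ?thesis using f(2) by (auto simp: tm_wf_def M_def)
  qed
  moreover have "tm_decides_within M w b k"
    if w: "set w \<subseteq> {..<5}" and
      run: "(cstep ^^ k) (p, \<lambda>i. (letter_at w i, {}), 0) = (if b then Accept else Reject, T, h)"
    for w k b T h
  proof -
    have sim: "\<exists>q T h. (cstep ^^ j) (p, \<lambda>i. (letter_at w i, {}), 0) = (q, T, h) \<and>
        q \<in> S \<and> (\<forall>i. T i \<in> syms H) \<and> tm_run M j w = (f q, sym_code \<circ> T, h)" for j
    proof (induction j)
      case 0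
      have "letter_at w i < 6" for i
      proof (cases "0 \<le> i \<and> i < int (length w)")
        case True
        then have "w ! nat i \<in> set w" by (intro nth_mem) linarith
        then show ?thesis using w by (auto simp: letter_at_def)
      qed (auto simp: letter_at_def)
      then show ?case
        using f(3) self_in_residuals[of p]
        by (simp add: S_def syms_def tm_run_def tm_init_letter_at comp_def)
    next
      case (Suc j)
      then obtain q T h where IH: "(cstep ^^ j) (p, \<lambda>i. (letter_at w i, {}), 0) = (q, T, h)"
        "q \<in> S" "\<forall>i. T i \<in> syms H" "tm_run M j w = (f q, sym_code \<circ> T, h)"
        by (elim exE conjE) (rule that)
      obtain q' s' m where st: "pstep q (T h) = (q', s', m)" by (metis prod_cases3)
      have "(cstep ^^ Suc j) (p, \<lambda>i. (letter_at w i, {}), 0) = (q', T(h := s'), h + m)"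
        using IH(1) st by simp
      moreover have "q' \<in> S" using closed[OF IH(2), of "T h"] st by simp
      moreover have "s' \<in> syms H"
        using acts_within_pstep[OF acts[OF IH(2)] _ st] IH(3) by simp
      \<comment> \<open>Both sides stand still at a verdict; elsewhere injectivity of
        \<open>f\<close> on \<open>S\<close> keeps the machine out of the states 1 and 2.\<close>
      moreover have "tm_run M (Suc j) w = (f q', sym_code \<circ> T(h := s'), h + m)"
      proof (cases "q = Accept \<or> q = Reject")
        case True
        then have "q' = q" "s' = T h" "m = 0" using st by auto
        then show ?thesis using IH(4) True f(4,5) by (auto simp: tm_run_def tm_step_def)
      next
        case False
        have "f q \<noteq> 1" "f q \<noteq> 2"
          using gf[OF IH(2)] gf[of Accept] gf[of Reject] f(4,5) False by (auto simp: S_def)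
        moreover have "\<delta> (f q) (sym_code (T h)) = (f q', sym_code s', m)"
          using st IH(3) by (simp add: \<delta>_def gf[OF IH(2)] sym_decode_code[of _ H])
        moreover have "(sym_code \<circ> T)(h := sym_code s') = sym_code \<circ> T(h := s')"
          by (rule ext) simp
        ultimately show ?thesis
          using IH(4) by (simp add: tm_run_def tm_step_def M_def comp_def fun_upd_def)
      qed
      ultimately show ?case using IH(3) by auto
    qed
    show ?thesis using sim[of k] run f(4,5) unfolding tm_decides_within_def by (auto split: if_splits)
  qed
  ultimately show thesis using that by blast
qed

section \<open>First-order logic with counting\<close>

datatype fm =
    Letter nat nat
  | Less nat nat
  | Neg fm
  | And fm fm
  | Count nat fm

text \<open>Variables are de Bruijn levels: at level d the variables below d are in scope and a count binds
  variable d.  Out-of-scope variables make an atom false, so formulas need no well-formedness condition.\<close>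

primrec eval :: "nat \<Rightarrow> fm \<Rightarrow> nat list \<Rightarrow> (nat \<Rightarrow> nat) \<Rightarrow> bool" where
  "eval d (Letter a x) w \<rho> \<longleftrightarrow> x < d \<and> \<rho> x < length w \<and> w ! \<rho> x = a" for d
| "eval d (Less x y) w \<rho> \<longleftrightarrow> x < d \<and> y < d \<and> \<rho> x < \<rho> y"
| "eval d (Neg \<phi>) w \<rho> \<longleftrightarrow> \<not> eval d \<phi> w \<rho>"
| "eval d (And \<phi> \<psi>) w \<rho> \<longleftrightarrow> eval d \<phi> w \<rho> \<and> eval d \<psi> w \<rho>"
| "eval d (Count y \<phi>) w \<rho> \<longleftrightarrow>
    y < d \<and> \<rho> y = card {x. x < length w \<and> eval (d + 1) \<phi> w (\<rho>(d := x))}"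

text \<open>Evaluating a subformula leaves the marks of inner variables at arbitrary cells; this
  makes such changes invisible.\<close>

lemma eval_cong: "(\<And>j. j < d \<Longrightarrow> \<rho> j = \<rho>' j) \<Longrightarrow> eval d \<phi> w \<rho> = eval d \<phi> w \<rho>'"
proof (induction \<phi> arbitrary: d \<rho> \<rho>')
  case (Count y \<phi>)
  have "eval (d + 1) \<phi> w (\<rho>(d := x)) = eval (d + 1) \<phi> w (\<rho>'(d := x))" for x
    using Count.prems by (intro Count.IH) auto
  then show ?case using Count.prems by auto
next
  case (And \<phi> \<psi>)
  from And.IH[OF And.prems] show ?case by simp
next
  case (Neg \<phi>)
  from Neg.IH[OF Neg.prems] show ?case by simp
qed auto

primrec depth :: "fm \<Rightarrow> nat" where
  "depth (Letter a x) = 0"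
| "depth (Less x y) = 0"
| "depth (Neg \<phi>) = depth \<phi>"
| "depth (And \<phi> \<psi>) = max (depth \<phi>) (depth \<psi>)"
| "depth (Count y \<phi>) = Suc (depth \<phi>)"

section \<open>Moving marks along the tape\<close>

definition tape :: "nat set \<Rightarrow> nat list \<Rightarrow> (nat \<Rightarrow> nat) \<Rightarrow> int \<Rightarrow> sym" where
  "tape M w e i = (letter_at w i, {j \<in> M. int (e j) = i})"

definition put :: "nat \<Rightarrow> sym \<Rightarrow> sym" where
  "put j s = (fst s, insert j (snd s))"

definition remove :: "nat \<Rightarrow> sym \<Rightarrow> sym" where
  "remove j s = (fst s, snd s - {j})"

text \<open>Works from any head position: once the head is at the left end, which mark 0 makes
  recognisable, the mark \<open>j\<close> can only lie to the right.\<close>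

definition goto :: "nat \<Rightarrow> sym prog" where
  "goto j = Seq (While (\<lambda>s. 0 \<notin> snd s) (Act id (-1))) (While (\<lambda>s. j \<notin> snd s) (Act id 1))"

definition zero :: "nat \<Rightarrow> sym prog" where
  "zero j = Seq (goto j) (Seq (Act (remove j) 0) (Seq (goto 0) (Act (put j) 0)))"

definition inc :: "nat \<Rightarrow> sym prog" where
  "inc j = Seq (goto j) (Seq (Act (remove j) 1) (Act (put j) 0))"

text \<open>Three steps per cell: unfolding the loop, the move, and discarding the finished
  body.\<close>

lemma reach_scan_left:
  assumes "\<And>y. x < y \<Longrightarrow> y \<le> z \<Longrightarrow> b (T (int y))" "\<not> b (T (int x))" "x \<le> z"
  shows "reach (3 * (z - x) + 1) (While b (Act id (-1)), T, int z) (Skip, T, int x)"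
  using assms
proof (induction "z - x" arbitrary: z)
  case 0
  then have "z = x" by simp
  with 0 show ?case by (auto intro: reach_mono[OF reach_While_exit])
next
  case (Suc k)
  then obtain z' where z': "z = Suc z'" "x \<le> z'" by (cases z) auto
  have "reach (3 * (z' - x) + 1) (While b (Act id (-1)), T, int z') (Skip, T, int x)"
    using Suc z' by (intro Suc.hyps(1)) auto
  moreover have "b (T (int z))" using z' by (intro Suc.prems(1)) auto
  moreover have "reach 1 (Act id (-1), T, int z) (Skip, T, int z')"
    using z' by (intro reach_Act) auto
  ultimately show ?case using z' by (rule_tac reach_While_iter[where s = 1]) auto
qed

lemma reach_scan_right:
  assumes "\<And>y. x \<le> y \<Longrightarrow> y < z \<Longrightarrow> b (T (int y))" "\<not> b (T (int z))" "x \<le> z"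
  shows "reach (3 * (z - x) + 1) (While b (Act id 1), T, int x) (Skip, T, int z)"
  using assms
proof (induction "z - x" arbitrary: x)
  case 0
  then have "z = x" by simp
  with 0 show ?case by (auto intro: reach_mono[OF reach_While_exit])
next
  case (Suc k)
  have "reach (3 * (z - Suc x) + 1) (While b (Act id 1), T, int (Suc x)) (Skip, T, int z)"
    using Suc by (intro Suc.hyps(1)) auto
  moreover have "b (T (int x))" using Suc by simp
  moreover have "reach 1 (Act id 1, T, int x) (Skip, T, int (Suc x))"
    by (intro reach_Act) auto
  ultimately show ?case using Suc.hyps(2) by (rule_tac reach_While_iter[where s = 1]) auto
qed

lemma reach_goto:
  assumes "0 \<in> M" "j \<in> M" "e 0 = 0" "e j \<le> L" "a \<le> L"
  shows "reach (6 * (L + 1)) (goto j, tape M w e, int a) (Skip, tape M w e, int (e j))"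
proof -
  have "reach (3 * (a - 0) + 1) (While (\<lambda>s. 0 \<notin> snd s) (Act id (-1)), tape M w e, int a)
      (Skip, tape M w e, int 0)"
    using assms by (intro reach_scan_left) (auto simp: tape_def)
  moreover have "reach (3 * (e j - 0) + 1) (While (\<lambda>s. j \<notin> snd s) (Act id 1), tape M w e, int 0)
      (Skip, tape M w e, int (e j))"
    using assms by (intro reach_scan_right) (auto simp: tape_def)
  ultimately show ?thesis
    unfolding goto_def using assms by (rule_tac reach_Seq_le) auto
qed

text \<open>A moving mark is absent for a moment; this is why \<open>tape\<close> carries the set of
  present marks apart from their positions.\<close>

lemma tape_put: "j \<notin> M \<Longrightarrow> (tape M w e)(int x := put j (tape M w e (int x))) = tape (insert j M) w (e(j := x))"
  by (rule ext) (auto simp: tape_def put_def)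

lemma tape_remove: "(tape M w e)(int (e j) := remove j (tape M w e (int (e j)))) = tape (M - {j}) w e"
proof
  fix i
  have "{k \<in> M. int (e k) = i} - {j} = {k \<in> M - {j}. int (e k) = i}" by blast
  moreover have "{k \<in> M. int (e k) = i} = {k \<in> M - {j}. int (e k) = i}" if "i \<noteq> int (e j)"
    using that by blast
  ultimately show "((tape M w e)(int (e j) := remove j (tape M w e (int (e j))))) i = tape (M - {j}) w e i"
    by (cases "i = int (e j)") (simp_all only: tape_def remove_def fun_upd_apply if_True if_False fst_conv snd_conv simp_thms)
qed

lemma reach_put:
  "j \<notin> M \<Longrightarrow> reach 1 (Act (put j) 0, tape M w e, int x) (Skip, tape (insert j M) w (e(j := x)), int x)"
  by (rule reach_Act) (simp_all add: tape_put)

text \<open>Mark \<open>j\<close> is off the tape while mark 0 is being searched, hence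
  \<open>j \<noteq> 0\<close>.\<close>

lemma reach_zero:
  assumes "0 \<in> M" "j \<in> M" "j \<noteq> 0" "e 0 = 0" "e j \<le> L" "a \<le> L"
  shows "reach (20 * (L + 1)) (zero j, tape M w e, int a) (Skip, tape M w (e(j := 0)), 0)"
proof -
  have "reach 1 (Act (put j) 0, tape (M - {j}) w e, int (e 0)) (Skip, tape M w (e(j := 0)), 0)"
    using reach_put[of j "M - {j}" w e 0] assms by (simp add: insert_absorb)
  moreover have "reach (6 * (L + 1)) (goto 0, tape (M - {j}) w e, int (e j))
      (Skip, tape (M - {j}) w e, int (e 0))"
    using assms by (intro reach_goto) auto
  ultimately have "reach (6 * (L + 1) + 2) (Seq (goto 0) (Act (put j) 0), tape (M - {j}) w e, int (e j))
      (Skip, tape M w (e(j := 0)), 0)"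
    by (rule_tac reach_Seq_le) auto
  moreover have "reach 1 (Act (remove j) 0, tape M w e, int (e j)) (Skip, tape (M - {j}) w e, int (e j))"
    by (rule reach_Act) (simp_all add: tape_remove)
  ultimately have "reach (6 * (L + 1) + 4)
      (Seq (Act (remove j) 0) (Seq (goto 0) (Act (put j) 0)), tape M w e, int (e j))
      (Skip, tape M w (e(j := 0)), 0)"
    by (rule_tac reach_Seq_le) auto
  with reach_goto[of M j e L a w] assms show ?thesis
    unfolding zero_def by (rule_tac reach_Seq_le) auto
qed

lemma reach_inc:
  assumes "0 \<in> M" "j \<in> M" "e 0 = 0" "e j \<le> L" "a \<le> L"
  shows "reach (20 * (L + 1)) (inc j, tape M w e, int a)
    (Skip, tape M w (e(j := Suc (e j))), int (Suc (e j)))"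
proof -
  have "reach 1 (Act (put j) 0, tape (M - {j}) w e, int (Suc (e j)))
      (Skip, tape M w (e(j := Suc (e j))), int (Suc (e j)))"
    using reach_put[of j "M - {j}" w e "Suc (e j)"] assms by (simp add: insert_absorb)
  moreover have "reach 1 (Act (remove j) 1, tape M w e, int (e j))
      (Skip, tape (M - {j}) w e, int (Suc (e j)))"
    by (rule reach_Act) (simp_all add: tape_remove)
  ultimately have "reach 3 (Seq (Act (remove j) 1) (Act (put j) 0), tape M w e, int (e j))
      (Skip, tape M w (e(j := Suc (e j))), int (Suc (e j)))"
    by (rule_tac reach_Seq_le) auto
  with reach_goto[of M j e L a w] assms show ?thesis
    unfolding inc_def by (rule_tac reach_Seq_le) auto
qed

text \<open>Variable x is the mark 2x, and the mark 2d + 1 is the counter of the count at level d.  The mark 0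
  never leaves cell 0; it serves both as the left end of the tape and as a variable with value 0.  The
  branches c1 and c2 are continuations, so that no truth value has to be stored.\<close>

primrec compile :: "nat \<Rightarrow> fm \<Rightarrow> sym prog \<Rightarrow> sym prog \<Rightarrow> sym prog" where
  "compile d (Letter l x) c1 c2 =
    (if x < d then Seq (goto (2 * x)) (Cond (\<lambda>s. fst s = l + 1) c1 c2) else c2)" for d
| "compile d (Less x y) c1 c2 =
    (if x < d \<and> y < d then
      Seq (goto 0) (Seq (While (\<lambda>s. 2 * x \<notin> snd s \<and> 2 * y \<notin> snd s) (Act id 1))
        (Cond (\<lambda>s. 2 * y \<notin> snd s) c1 c2))
     else c2)"
| "compile d (Neg \<phi>) c1 c2 = compile d \<phi> c2 c1"
| "compile d (And \<phi> \<psi>) c1 c2 = compile d \<phi> (compile d \<psi> c1 c2) c2"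
| "compile d (Count y \<phi>) c1 c2 =
    (if y < d then
      Seq (zero (2 * d + 1)) (Seq (zero (2 * d))
        (Seq (While (\<lambda>s. fst s \<noteq> 0) (Seq (compile (d + 1) \<phi> (inc (2 * d + 1)) Skip) (inc (2 * d))))
          (Seq (goto (2 * y)) (Cond (\<lambda>s. 2 * d + 1 \<in> snd s) c1 c2))))
     else c2)"

text \<open>Only the steps until a continuation takes over are counted, so the times of conjuncts
  add. In a count, 43 is 20 for the counter, 20 for the variable and 3 for control; 100 generously
  covers both resets, the last search and the test.\<close>

primrec time :: "fm \<Rightarrow> nat \<Rightarrow> nat" where
  "time (Letter l x) L = 20 * (L + 1)"
| "time (Less x y) L = 20 * (L + 1)"
| "time (Neg \<phi>) L = time \<phi> L"
| "time (And \<phi> \<psi>) L = time \<phi> L + time \<psi> L"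
| "time (Count y \<phi>) L = (L + 1) * (time \<phi> L + 43 * (L + 1)) + 100 * (L + 1)"

text \<open>With \<open>L\<close> the length of the word, position \<open>L\<close> is allowed: on
  this first blank the loop variable stops, and a counter that counted every position ends
  there.\<close>

definition admissible :: "nat \<Rightarrow> (nat \<Rightarrow> nat) \<Rightarrow> nat \<Rightarrow> bool" where
  "admissible L e a \<longleftrightarrow> e 0 = 0 \<and> (\<forall>j. e j \<le> L) \<and> a \<le> L"

text \<open>Mark \<open>b\<close> is the bound variable and \<open>b + 1\<close> its counter. The
  fixed \<open>e0\<close> records the outer variables, while the body may spoil all marks from
  \<open>b + 2\<close> on. The invariant that the counter is at most the position keeps it within
  \<open>L\<close> when it is incremented.\<close>

lemma reach_count_loop:
  fixes w :: "nat list" and b H :: nat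
  defines "L \<equiv> length w" and "M \<equiv> {..<H}"
  assumes body: "\<And>e a. admissible L e a \<Longrightarrow> (\<And>j. j < b \<Longrightarrow> e j = e0 j) \<Longrightarrow> e b < L \<Longrightarrow>
      \<exists>e' a'. reach B (p, tape M w e, int a) (if P (e b) then inc (b + 1) else Skip, tape M w e', int a')
        \<and> admissible L e' a' \<and> (\<forall>j<b + 2. e' j = e j)"
    and b: "0 < b" "b + 2 \<le> H"
    and e: "admissible L e (e b)" "\<And>j. j < b \<Longrightarrow> e j = e0 j" "e (b + 1) \<le> e b"
  shows "\<exists>e'. reach ((L - e b) * (B + 43 * (L + 1)) + 1)
        (While (\<lambda>s. fst s \<noteq> 0) (Seq p (inc b)), tape M w e, int (e b)) (Skip, tape M w e', int L)
      \<and> admissible L e' L \<and> (\<forall>j<b. e' j = e0 j)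
      \<and> e' (b + 1) = e (b + 1) + card {x. e b \<le> x \<and> x < L \<and> P x}"
  using e
proof (induction "L - e b" arbitrary: e)
  case 0
  then have "e b = L" by (simp add: admissible_def)
  moreover have "reach 1 (While (\<lambda>s. fst s \<noteq> 0) (Seq p (inc b)), tape M w e, int L) (Skip, tape M w e, int L)"
    by (rule reach_While_exit) (simp add: tape_def letter_at_def L_def)
  moreover have "{x. L \<le> x \<and> x < L \<and> P x} = {}" by auto
  ultimately show ?case using 0 by (intro exI[of _ e]) (simp add: admissible_def)
next
  case (Suc k)
  define x where "x = e b"
  have x: "x < L" using Suc.hyps(2) by (simp add: x_def)
  obtain e1 a1 where r1: "reach B (p, tape M w e, int x)
      (if P x then inc (b + 1) else Skip, tape M w e1, int a1)"
    and e1: "admissible L e1 a1" "\<And>j. j < b + 2 \<Longrightarrow> e1 j = e j"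
    using body[OF Suc.prems(1,2)] x unfolding x_def by blast
  have e1b: "e1 b = x" "e1 (b + 1) = e (b + 1)" using e1(2) by (simp_all add: x_def)
  have M: "0 \<in> M" "b \<in> M" "b + 1 \<in> M" using b by (auto simp: M_def)
  define e2 where "e2 = (if P x then e1(b + 1 := Suc (e1 (b + 1))) else e1)"
  define a2 where "a2 = (if P x then Suc (e1 (b + 1)) else a1)"
  have c: "e1 (b + 1) \<le> x" using e1b(2) Suc.prems(3) by (simp add: x_def)
  have "reach (20 * (L + 1)) (if P x then inc (b + 1) else Skip, tape M w e1, int a1) (Skip, tape M w e2, int a2)"
  proof (cases "P x")
    case True
    then show ?thesis
      using reach_inc[of M "b + 1" e1 L a1 w] M e1(1) by (simp add: e2_def a2_def admissible_def)
  qed (simp add: e2_def a2_def reach_refl)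
  from reach_trans[OF r1 this]
  have r2: "reach (B + 20 * (L + 1)) (p, tape M w e, int x) (Skip, tape M w e2, int a2)" .
  have e2: "e2 b = x" "\<And>j. j < b \<Longrightarrow> e2 j = e0 j" "admissible L e2 a2"
    "e2 (b + 1) = e (b + 1) + (if P x then 1 else 0)"
    using e1 e1b c x b Suc.prems(2) by (auto simp: e2_def a2_def admissible_def)
  define e3 where "e3 = e2(b := Suc x)"
  have r3: "reach (20 * (L + 1)) (inc b, tape M w e2, int a2) (Skip, tape M w e3, int (Suc x))"
    using reach_inc[of M b e2 L a2 w] M e2(1,3) x by (simp add: e3_def admissible_def)
  have e3: "e3 b = Suc x" "\<And>j. j < b \<Longrightarrow> e3 j = e0 j" "admissible L e3 (Suc x)"
    "e3 (b + 1) = e (b + 1) + (if P x then 1 else 0)"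
    using e2 x b by (auto simp: e3_def admissible_def)
  have "\<exists>e'. reach ((L - e3 b) * (B + 43 * (L + 1)) + 1)
        (While (\<lambda>s. fst s \<noteq> 0) (Seq p (inc b)), tape M w e3, int (e3 b)) (Skip, tape M w e', int L)
      \<and> admissible L e' L \<and> (\<forall>j<b. e' j = e0 j)
      \<and> e' (b + 1) = e3 (b + 1) + card {x. e3 b \<le> x \<and> x < L \<and> P x}"
    using Suc.hyps(2) Suc.prems(3) e3 by (intro Suc.hyps(1)) (auto simp: x_def)
  then obtain e' where r4: "reach ((L - Suc x) * (B + 43 * (L + 1)) + 1)
        (While (\<lambda>s. fst s \<noteq> 0) (Seq p (inc b)), tape M w e3, int (Suc x)) (Skip, tape M w e', int L)"
    and e': "admissible L e' L" "\<forall>j<b. e' j = e0 j"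
      "e' (b + 1) = e3 (b + 1) + card {z. Suc x \<le> z \<and> z < L \<and> P z}"
    using e3(1) by auto
  have r23: "reach (B + 20 * (L + 1) + 20 * (L + 1) + 1) (Seq p (inc b), tape M w e, int x)
      (Skip, tape M w e3, int (Suc x))"
    using r2 r3 by (rule reach_Seq_le) simp
  have "L - x = Suc (L - Suc x)" using x by simp
  then have t: "B + 20 * (L + 1) + 20 * (L + 1) + 1 + ((L - Suc x) * (B + 43 * (L + 1)) + 1) + 2
      \<le> (L - x) * (B + 43 * (L + 1)) + 1"
    by simp
  have "fst (tape M w e (int x)) \<noteq> 0" using x by (simp add: tape_def letter_at_def L_def)
  then have "reach ((L - x) * (B + 43 * (L + 1)) + 1)
        (While (\<lambda>s. fst s \<noteq> 0) (Seq p (inc b)), tape M w e, int x) (Skip, tape M w e', int L)"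
    using reach_While_iter[where b = "\<lambda>s. fst s \<noteq> 0", OF _ r23 r4 t] by simp
  moreover have "{z. x \<le> z \<and> z < L \<and> P z} = (if P x then {x} else {}) \<union> {z. Suc x \<le> z \<and> z < L \<and> P z}"
    using x by (auto simp: not_less_eq_eq dest: le_antisym)
  then have "card {z. x \<le> z \<and> z < L \<and> P z} = (if P x then 1 else 0) + card {z. Suc x \<le> z \<and> z < L \<and> P z}"
    by (auto simp: card_insert_if)
  then have "e' (b + 1) = e (b + 1) + card {z. x \<le> z \<and> z < L \<and> P z}"
    using e'(3) e3(4) by simp
  ultimately show ?case using e'(1,2) unfolding x_def by blast
qed

text \<open>The continuations vary in the induction because \<open>Neg\<close> exchanges them and
  \<open>And\<close> nests them. The condition \<open>1 \<le> d\<close> protects the left end: a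
  count resets mark \<open>2 * d\<close>, which must not be mark 0. Marks from \<open>2 * d\<close>
  on are scratch.\<close>

lemma reach_compile:
  assumes "1 \<le> d" "2 * (d + depth \<phi>) \<le> H" "admissible (length w) e a"
  shows "\<exists>e' a'. reach (time \<phi> (length w)) (compile d \<phi> c1 c2, tape {..<H} w e, int a)
      (if eval d \<phi> w (\<lambda>j. e (2 * j)) then c1 else c2, tape {..<H} w e', int a')
    \<and> admissible (length w) e' a' \<and> (\<forall>j<2 * d. e' j = e j)"
  using assms
proof (induction \<phi> arbitrary: d e a c1 c2)
  case (Letter l x)
  let ?L = "length w" and ?T = "tape {..<H} w e"
  show ?case
  proof (cases "x < d")
    case True
    have "reach (6 * (?L + 1)) (goto (2 * x), ?T, int a) (Skip, ?T, int (e (2 * x)))"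
      using True Letter.prems by (intro reach_goto) (auto simp: admissible_def)
    moreover have "reach 1 (Cond (\<lambda>s. fst s = l + 1) c1 c2, ?T, int (e (2 * x)))
        (if eval d (Letter l x) w (\<lambda>j. e (2 * j)) then c1 else c2, ?T, int (e (2 * x)))"
      using reach_Cond[of "\<lambda>s. fst s = l + 1" c1 c2 ?T "int (e (2 * x))"] True
      by (simp add: tape_def letter_at_def split: if_splits)
    ultimately have "reach (20 * (?L + 1)) (compile d (Letter l x) c1 c2, ?T, int a)
        (if eval d (Letter l x) w (\<lambda>j. e (2 * j)) then c1 else c2, ?T, int (e (2 * x)))"
      using True by (simp only: compile.simps if_True) (rule reach_Seq_le, assumption+, simp)
    then show ?thesis
      using Letter.prems by (intro exI[of _ e] exI[of _ "e (2 * x)"]) (simp add: admissible_def)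
  next
    case False
    then show ?thesis
      using Letter.prems by (intro exI[of _ e] exI[of _ a]) (simp add: reach_refl)
  qed
next
  case (Less x y)
  let ?L = "length w" and ?T = "tape {..<H} w e"
  show ?case
  proof (cases "x < d \<and> y < d")
    case True
    \<comment> \<open>The scan stops at the smaller value; there the mark of \<open>y\<close> is
      missing iff \<open>x\<close> comes strictly first.\<close>
    define m where "m = min (e (2 * x)) (e (2 * y))"
    have m: "m \<le> ?L" using Less.prems by (simp add: m_def admissible_def min.coboundedI1)
    have xy: "2 * x < H" "2 * y < H" using True Less.prems by auto
    have "reach (6 * (?L + 1)) (goto 0, ?T, int a) (Skip, ?T, int 0)"
      using True Less.prems reach_goto[of "{..<H}" 0 e ?L a w] by (auto simp: admissible_def)
    moreover have "reach (3 * (m - 0) + 1)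
        (While (\<lambda>s. 2 * x \<notin> snd s \<and> 2 * y \<notin> snd s) (Act id 1), ?T, int 0) (Skip, ?T, int m)"
      using xy by (intro reach_scan_right) (auto simp: tape_def m_def min_def split: if_splits)
    moreover have "reach 1 (Cond (\<lambda>s. 2 * y \<notin> snd s) c1 c2, ?T, int m)
        (if eval d (Less x y) w (\<lambda>j. e (2 * j)) then c1 else c2, ?T, int m)"
    proof -
      have "2 * y \<notin> snd (?T (int m)) \<longleftrightarrow> eval d (Less x y) w (\<lambda>j. e (2 * j))"
        using xy True by (auto simp: tape_def m_def min_def)
      then show ?thesis using reach_Cond[of "\<lambda>s. 2 * y \<notin> snd s" c1 c2 ?T "int m"] by simp
    qed
    ultimately have "reach (6 * (?L + 1) + (3 * (m - 0) + 1 + 1 + 1) + 1) (compile d (Less x y) c1 c2, ?T, int a)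
        (if eval d (Less x y) w (\<lambda>j. e (2 * j)) then c1 else c2, ?T, int m)"
      using True by (simp only: compile.simps if_True simp_thms) (rule reach_Seq_le, assumption, rule reach_Seq_le, assumption+, rule order_refl, simp)
    then have "reach (20 * (?L + 1)) (compile d (Less x y) c1 c2, ?T, int a)
        (if eval d (Less x y) w (\<lambda>j. e (2 * j)) then c1 else c2, ?T, int m)"
      by (rule reach_mono) (use m in simp)
    then show ?thesis
      using Less.prems m by (intro exI[of _ e] exI[of _ m]) (simp add: admissible_def)
  next
    case False
    then show ?thesis
      using Less.prems by (intro exI[of _ e] exI[of _ a]) (auto simp add: reach_refl)
  qed
next
  case (Neg \<phi>)
  from Neg.IH[of d e a c2 c1] Neg.prems show ?case
    by (cases "eval d \<phi> w (\<lambda>j. e (2 * j))") simp_all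
next
  case (And \<phi> \<psi>)
  let ?L = "length w" and ?T = "tape {..<H} w"
  have H: "2 * (d + depth \<phi>) \<le> H" "2 * (d + depth \<psi>) \<le> H" using And.prems(2) by auto
  obtain e1 a1 where r1: "reach (time \<phi> ?L) (compile d \<phi> (compile d \<psi> c1 c2) c2, ?T e, int a)
      (if eval d \<phi> w (\<lambda>j. e (2 * j)) then compile d \<psi> c1 c2 else c2, ?T e1, int a1)"
    and e1: "admissible ?L e1 a1" "\<forall>j<2 * d. e1 j = e j"
    using And.IH(1)[OF And.prems(1) H(1) And.prems(3)] by blast
  show ?case
  proof (cases "eval d \<phi> w (\<lambda>j. e (2 * j))")
    case True
    obtain e2 a2 where r2: "reach (time \<psi> ?L) (compile d \<psi> c1 c2, ?T e1, int a1)
        (if eval d \<psi> w (\<lambda>j. e1 (2 * j)) then c1 else c2, ?T e2, int a2)"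
      and e2: "admissible ?L e2 a2" "\<forall>j<2 * d. e2 j = e1 j"
      using And.IH(2)[OF And.prems(1) H(2) e1(1)] by blast
    have "eval d \<psi> w (\<lambda>j. e1 (2 * j)) = eval d \<psi> w (\<lambda>j. e (2 * j))"
      using e1(2) by (intro eval_cong) simp
    then have "reach (time \<phi> ?L + time \<psi> ?L) (compile d (And \<phi> \<psi>) c1 c2, ?T e, int a)
        (if eval d (And \<phi> \<psi>) w (\<lambda>j. e (2 * j)) then c1 else c2, ?T e2, int a2)"
      using reach_trans[of _ _ _ _ "(if eval d \<psi> w (\<lambda>j. e1 (2 * j)) then c1 else c2, ?T e2, int a2)"] r1 r2 True by simp
    then show ?thesis using e1 e2 by (intro exI[of _ e2] exI[of _ a2]) simp
  next
    case False
    then have "reach (time \<phi> ?L + time \<psi> ?L) (compile d (And \<phi> \<psi>) c1 c2, ?T e, int a)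
        (if eval d (And \<phi> \<psi>) w (\<lambda>j. e (2 * j)) then c1 else c2, ?T e1, int a1)"
      using reach_mono[OF r1] by simp
    then show ?thesis using e1 by (intro exI[of _ e1] exI[of _ a1]) simp
  qed
next
  case (Count y \<phi>)
  let ?L = "length w" and ?T = "tape {..<H} w"
  show ?case
  proof (cases "y < d")
    case True
    define P where "P x \<longleftrightarrow> eval (d + 1) \<phi> w ((\<lambda>j. e (2 * j))(d := x))" for x
    define e1 where "e1 = e(2 * d + 1 := 0)"
    define e2 where "e2 = e1(2 * d := 0)"
    have H: "2 * d + 2 \<le> H" "2 * (d + 1 + depth \<phi>) \<le> H" using Count.prems(2) by auto
    have r1: "reach (20 * (?L + 1)) (zero (2 * d + 1), ?T e, int a) (Skip, ?T e1, int 0)"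
      using reach_zero[of "{..<H}" "2 * d + 1" e ?L a w] H Count.prems by (auto simp: e1_def admissible_def)
    have e1: "admissible ?L e1 0" using Count.prems(3) by (auto simp: admissible_def e1_def)
    have r2: "reach (20 * (?L + 1)) (zero (2 * d), ?T e1, int 0) (Skip, ?T e2, int 0)"
      using reach_zero[of "{..<H}" "2 * d" e1 ?L 0 w] H Count.prems(1) e1 by (auto simp: e2_def admissible_def)
    have e2: "admissible ?L e2 (e2 (2 * d))" "\<And>j. j < 2 * d \<Longrightarrow> e2 j = e j" "e2 (2 * d) = 0" "e2 (2 * d + 1) = 0"
      using e1 Count.prems(1) by (auto simp: admissible_def e1_def e2_def)
    have body: "\<exists>e'' a''. reach (time \<phi> ?L)
        (compile (d + 1) \<phi> (inc (2 * d + 1)) Skip, ?T e', int a')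
        (if P (e' (2 * d)) then inc (2 * d + 1) else Skip, ?T e'', int a'')
        \<and> admissible ?L e'' a'' \<and> (\<forall>j<2 * d + 2. e'' j = e' j)"
      if "admissible ?L e' a'" "\<And>j. j < 2 * d \<Longrightarrow> e' j = e j" for e' a'
    proof -
      have "eval (d + 1) \<phi> w (\<lambda>j. e' (2 * j)) = P (e' (2 * d))"
        unfolding P_def using that(2) by (intro eval_cong) (auto simp: less_Suc_eq)
      with Count.IH[of "d + 1" e' a' "inc (2 * d + 1)" Skip] H(2) that(1) show ?thesis by simp
    qed
    have "\<exists>e'. reach ((?L - e2 (2 * d)) * (time \<phi> ?L + 43 * (?L + 1)) + 1)
        (While (\<lambda>s. fst s \<noteq> 0) (Seq (compile (d + 1) \<phi> (inc (2 * d + 1)) Skip) (inc (2 * d))), ?T e2, int (e2 (2 * d)))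
        (Skip, ?T e', int ?L)
      \<and> admissible ?L e' ?L \<and> (\<forall>j<2 * d. e' j = e j)
      \<and> e' (2 * d + 1) = e2 (2 * d + 1) + card {x. e2 (2 * d) \<le> x \<and> x < ?L \<and> P x}"
    proof (rule reach_count_loop)
      show "0 < 2 * d" "2 * d + 2 \<le> H" using Count.prems(1) H(1) by simp_all
      show "e2 (2 * d + 1) \<le> e2 (2 * d)" using e2(4) by simp
      show "admissible ?L e2 (e2 (2 * d))" by (fact e2(1))
    qed (rule body, assumption+, rule e2(2))
    then obtain e3 where raw: "reach ((?L - e2 (2 * d)) * (time \<phi> ?L + 43 * (?L + 1)) + 1)
        (While (\<lambda>s. fst s \<noteq> 0) (Seq (compile (d + 1) \<phi> (inc (2 * d + 1)) Skip) (inc (2 * d))), ?T e2, int (e2 (2 * d)))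
        (Skip, ?T e3, int ?L)"
      and e3: "admissible ?L e3 ?L" "\<forall>j<2 * d. e3 j = e j"
        "e3 (2 * d + 1) = e2 (2 * d + 1) + card {x. e2 (2 * d) \<le> x \<and> x < ?L \<and> P x}"
      by (elim exE conjE) (rule that)
    note r3 = raw[unfolded e2(3) minus_nat.diff_0]
    have count: "e3 (2 * d + 1) = card {x. x < ?L \<and> P x}"
      unfolding e3(3) e2(3,4) by simp
    have ey: "e3 (2 * y) = e (2 * y)" using e3(2) True by simp
    have r4: "reach (6 * (?L + 1)) (goto (2 * y), ?T e3, int ?L) (Skip, ?T e3, int (e (2 * y)))"
    proof -
      have "e (2 * y) \<le> ?L" using Count.prems(3) by (simp add: admissible_def)
      then show ?thesis
        using reach_goto[of "{..<H}" "2 * y" e3 ?L ?L w] True H(1) e3(1) ey by (simp add: admissible_def)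
    qed
    \<comment> \<open>Equality of \<open>y\<close> with the count is tested without arithmetic: both
      marks share a cell.\<close>
    have r5: "reach 1 (Cond (\<lambda>s. 2 * d + 1 \<in> snd s) c1 c2, ?T e3, int (e (2 * y)))
        (if eval d (Count y \<phi>) w (\<lambda>j. e (2 * j)) then c1 else c2, ?T e3, int (e (2 * y)))"
    proof -
      have "2 * d + 1 \<in> snd (?T e3 (int (e (2 * y)))) \<longleftrightarrow> eval d (Count y \<phi>) w (\<lambda>j. e (2 * j))"
        using H(1) True count by (auto simp: tape_def P_def)
      then show ?thesis
        using reach_Cond[of "\<lambda>s. 2 * d + 1 \<in> snd s" c1 c2 "?T e3" "int (e (2 * y))"] by simp
    qed
    have "reach (time (Count y \<phi>) ?L) (compile d (Count y \<phi>) c1 c2, ?T e, int a)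
        (if eval d (Count y \<phi>) w (\<lambda>j. e (2 * j)) then c1 else c2, ?T e3, int (e (2 * y)))"
    proof -
      have s1: "reach (6 * (?L + 1) + 2) (Seq (goto (2 * y)) (Cond (\<lambda>s. 2 * d + 1 \<in> snd s) c1 c2), ?T e3, int ?L)
        (if eval d (Count y \<phi>) w (\<lambda>j. e (2 * j)) then c1 else c2, ?T e3, int (e (2 * y)))"
        using r4 r5 by (rule reach_Seq_le) simp
      note s2 = reach_Seq_le[OF r3 s1 order_refl]
      note s3 = reach_Seq_le[OF r2 s2 order_refl]
      note s4 = reach_Seq_le[OF r1 s3]
      show ?thesis using True by (simp only: compile.simps if_True) (rule s4, simp)
    qed
    then show ?thesis
      using e3 Count.prems(3) by (intro exI[of _ e3] exI[of _ "e (2 * y)"]) (simp add: admissible_def)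
  next
    case False
    then show ?thesis
      using Count.prems by (intro exI[of _ e] exI[of _ a]) (simp add: reach_refl)
  qed
qed

section \<open>Alphabet and running time of compiled formulas\<close>

lemma preserves_id: "preserves S id"
  by (simp add: preserves_def)

lemma preserves_put: "j < H \<Longrightarrow> preserves (syms H) (put j)"
  by (auto simp: preserves_def put_def syms_def)

lemma preserves_remove: "preserves (syms H) (remove j)"
  by (auto simp: preserves_def remove_def syms_def)

lemma acts_within_compile:
  "2 * (d + depth \<phi>) \<le> H \<Longrightarrow> acts_within (syms H) c1 \<Longrightarrow> acts_within (syms H) c2 \<Longrightarrow>
    acts_within (syms H) (compile d \<phi> c1 c2)"
proof (induction \<phi> arbitrary: d c1 c2)
  case (Count y \<phi>)
  have "acts_within (syms H) (compile (d + 1) \<phi> (inc (2 * d + 1)) Skip)"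
    using Count.prems(1)
    by (intro Count.IH) (simp_all add: inc_def goto_def preserves_id preserves_put preserves_remove)
  then show ?case
    using Count.prems by (simp add: zero_def inc_def goto_def preserves_id preserves_put preserves_remove)
qed (simp_all add: goto_def preserves_id)

lemma time_polynomial: "\<exists>c k. \<forall>L. time \<phi> L \<le> c * (L + 1) ^ k"
proof (induction \<phi>)
  case (Letter l x)
  show ?case by (intro exI[of _ 20] exI[of _ 1]) simp
next
  case (Less x y)
  show ?case by (intro exI[of _ 20] exI[of _ 1]) simp
next
  case (Neg \<phi>)
  then show ?case by simp
next
  case (And \<phi> \<psi>)
  then obtain c k c' k' where *: "\<And>L. time \<phi> L \<le> c * (L + 1) ^ k" "\<And>L. time \<psi> L \<le> c' * (L + 1) ^ k'"
    by blast
  have "time (And \<phi> \<psi>) L \<le> (c + c') * (L + 1) ^ (k + k')" for L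
  proof -
    have "(L + 1) ^ k \<le> (L + 1) ^ (k + k')" "(L + 1) ^ k' \<le> (L + 1) ^ (k + k')"
      by (rule power_increasing; simp)+
    then have "c * (L + 1) ^ k \<le> c * (L + 1) ^ (k + k')" "c' * (L + 1) ^ k' \<le> c' * (L + 1) ^ (k + k')"
      by (auto intro: mult_le_mono2)
    then have "time \<phi> L \<le> c * (L + 1) ^ (k + k')" "time \<psi> L \<le> c' * (L + 1) ^ (k + k')"
      using *[of L] le_trans by blast+
    then show ?thesis by (simp add: add_mult_distrib)
  qed
  then show ?case by blast
next
  case (Count y \<phi>)
  then obtain c k where *: "\<And>L. time \<phi> L \<le> c * (L + 1) ^ k" by blast
  \<comment> \<open>The exponent is \<open>k + 2\<close> and not \<open>k + 1\<close>, so that it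
    dominates the square even for \<open>k = 0\<close>; 143 is 43 + 100.\<close>
  have "time (Count y \<phi>) L \<le> (c + 143) * (L + 1) ^ (k + 2)" for L
  proof -
    have "(L + 1) ^ (k + 1) \<le> (L + 1) ^ (k + 2)" "(L + 1) ^ 2 \<le> (L + 1) ^ (k + 2)"
      "(L + 1) ^ 1 \<le> (L + 1) ^ (k + 2)"
      by (rule power_increasing; simp)+
    then have "c * (L + 1) ^ (k + 1) + 43 * (L + 1) ^ 2 + 100 * (L + 1) ^ 1
        \<le> c * (L + 1) ^ (k + 2) + 43 * (L + 1) ^ (k + 2) + 100 * (L + 1) ^ (k + 2)"
      by (intro add_mono mult_le_mono2)
    also have "\<dots> = (c + 143) * (L + 1) ^ (k + 2)" by (simp add: algebra_simps)
    finally have 1: "c * (L + 1) ^ (k + 1) + 43 * (L + 1) ^ 2 + 100 * (L + 1) ^ 1 \<le> (c + 143) * (L + 1) ^ (k + 2)" .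
    have "(L + 1) * time \<phi> L \<le> (L + 1) * (c * (L + 1) ^ k)" using * by (rule mult_le_mono2)
    also have "\<dots> = c * (L + 1) ^ (k + 1)" by (simp add: algebra_simps)
    finally have "time (Count y \<phi>) L \<le> c * (L + 1) ^ (k + 1) + 43 * (L + 1) ^ 2 + 100 * (L + 1) ^ 1"
      by (simp add: power2_eq_square add_mult_distrib2)
    with 1 show ?thesis by (rule le_trans[rotated])
  qed
  then show ?case by blast
qed

theorem fm_decidable_in_polynomial_time:
  "\<exists>M c k. tm_wf M \<and> (\<forall>w. set w \<subseteq> {..<5} \<longrightarrow>
    (\<exists>t \<le> c * length w ^ k + c. tm_decides_within M w (eval 1 \<phi> w (\<lambda>_. 0)) t))"
proof -
  define H where "H = 2 * (1 + depth \<phi>)"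
  \<comment> \<open>A single step puts all marks on cell 0, which starts every variable and counter
    at 0.\<close>
  define p where "p = Seq (Act (\<lambda>s. (fst s, {..<H})) 0) (compile 1 \<phi> Accept Reject)"
  have "acts_within (syms H) p"
    using acts_within_compile[of 1 \<phi> H Accept Reject]
    by (auto simp: p_def H_def preserves_def syms_def)
  then obtain M where M: "tm_wf M"
    "\<And>w k b T h. set w \<subseteq> {..<5} \<Longrightarrow>
      (cstep ^^ k) (p, \<lambda>i. (letter_at w i, {}), 0) = (if b then Accept else Reject, T, h) \<Longrightarrow>
      tm_decides_within M w b k"
    by (rule prog_to_tm) (auto simp: p_def)
  obtain c k where ck: "\<And>L. time \<phi> L \<le> c * (L + 1) ^ k" using time_polynomial by blast
  have "\<exists>t \<le> (c * 2 ^ k + c + 2) * length w ^ k + (c * 2 ^ k + c + 2).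
      tm_decides_within M w (eval 1 \<phi> w (\<lambda>_. 0)) t" if w: "set w \<subseteq> {..<5}" for w
  proof -
    let ?L = "length w"
    obtain e' a' where r: "reach (time \<phi> ?L) (compile 1 \<phi> Accept Reject, tape {..<H} w (\<lambda>_. 0), int 0)
        (if eval 1 \<phi> w (\<lambda>_. 0) then Accept else Reject, tape {..<H} w e', int a')"
      using reach_compile[of 1 \<phi> H w "\<lambda>_. 0" 0 Accept Reject] by (auto simp: admissible_def H_def)
    have "(\<lambda>i. (letter_at w i, {}))(0 := (letter_at w 0, {..<H})) = tape {..<H} w (\<lambda>_. 0)"
      by (rule ext) (auto simp: tape_def)
    then have "reach 1 (Act (\<lambda>s. (fst s, {..<H})) 0, \<lambda>i. (letter_at w i, {}), 0)
        (Skip, tape {..<H} w (\<lambda>_. 0), int 0)"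
      by (intro reach_Act) simp_all
    from reach_Seq_le[OF this r order_refl] obtain t where t: "t \<le> 1 + time \<phi> ?L + 1"
      "(cstep ^^ t) (p, \<lambda>i. (letter_at w i, {}), 0)
        = (if eval 1 \<phi> w (\<lambda>_. 0) then Accept else Reject, tape {..<H} w e', int a')"
      unfolding reach_def p_def by blast
    \<comment> \<open>The bound is required in powers of the length itself:
      \<open>?L + 1 \<le> 2 * ?L\<close> for a nonempty word, and the summand 1 covers the empty
      one.\<close>
    have "(?L + 1) ^ k \<le> 2 ^ k * ?L ^ k + 1"
    proof (cases "?L = 0")
      case False
      then have "(?L + 1) ^ k \<le> (2 * ?L) ^ k" by (intro power_mono) (simp_all add: Suc_le_eq)
      then show ?thesis by (simp add: power_mult_distrib)
    qed simp
    then have "c * (?L + 1) ^ k \<le> c * (2 ^ k * ?L ^ k + 1)" by (rule mult_le_mono2)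
    also have "\<dots> \<le> (c * 2 ^ k + c + 2) * ?L ^ k + c" by (simp add: algebra_simps)
    finally have "1 + time \<phi> ?L + 1 \<le> (c * 2 ^ k + c + 2) * ?L ^ k + (c * 2 ^ k + c + 2)"
      using ck[of ?L] by simp
    with t(1) M(2)[OF w t(2)] show ?thesis by (intro exI[of _ t]) simp
  qed
  with M(1) show ?thesis by blast
qed

section \<open>Reading nested sequences by counting brackets\<close>

definition balance :: "nat list \<Rightarrow> int" where
  "balance u = int (count_list u 2) - int (count_list u 3)"

lemma balance_Nil [simp]: "balance [] = 0"
  by (simp add: balance_def)

lemma balance_Cons: "balance (a # u) = (if a = 2 then 1 else if a = 3 then -1 else 0) + balance u"
  by (simp add: balance_def)

lemma balance_append [simp]: "balance (u @ v) = balance u + balance v"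
  by (simp add: balance_def)

lemma balance_no_brackets: "2 \<notin> set u \<Longrightarrow> 3 \<notin> set u \<Longrightarrow> balance u = 0"
  by (simp add: balance_def count_list_0_iff)

text \<open>A comma separates items of the outermost sequence iff the brackets before it are balanced.\<close>

definition tops :: "nat \<Rightarrow> nat list \<Rightarrow> nat set" where
  "tops a u = {s. s < length u \<and> u ! s = a \<and> balance (take s u) = 0}"

lemma finite_tops [simp]: "finite (tops a u)"
  by (simp add: tops_def)

lemma tops_Nil [simp]: "tops a [] = {}"
  by (simp add: tops_def)

lemma card_tops_append:
  assumes "balance u = 0"
  shows "card (tops a (u @ v)) = card (tops a u) + card (tops a v)"
proof -
  have "tops a (u @ v) = tops a u \<union> (\<lambda>s. s + length u) ` tops a v"
  proof (intro set_eqI iffI)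
    fix s assume s: "s \<in> tops a (u @ v)"
    show "s \<in> tops a u \<union> (\<lambda>s. s + length u) ` tops a v"
    proof (cases "s < length u")
      case True
      with s show ?thesis by (auto simp: tops_def nth_append)
    next
      case False
      then have "s - length u \<in> tops a v" using s assms by (auto simp: tops_def nth_append)
      moreover have "s = s - length u + length u" using False by simp
      ultimately show ?thesis by blast
    qed
  next
    fix s assume "s \<in> tops a u \<union> (\<lambda>s. s + length u) ` tops a v"
    then show "s \<in> tops a (u @ v)" using assms by (auto simp: tops_def nth_append)
  qed
  moreover have "tops a u \<inter> (\<lambda>s. s + length u) ` tops a v = {}" by (auto simp: tops_def)
  ultimately show ?thesis by (simp add: card_Un_disjoint card_image inj_on_def)
qed

text \<open>Here \<open>u\<close> is the text from behind an opening bracket up to a place in item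
  \<open>i\<close> outside its inner brackets. A closing bracket at top level would mean that the
  sequence has already ended.\<close>

definition item_prefix :: "nat \<Rightarrow> nat list \<Rightarrow> bool" where
  "item_prefix i u \<longleftrightarrow> balance u = 0 \<and> card (tops 4 u) = i \<and> tops 3 u = {}"

text \<open>What a text must satisfy to be an item: it contributes no separator to the surrounding
  sequence and no bracket that closes it.\<close>

definition clean :: "nat list \<Rightarrow> bool" where
  "clean x \<longleftrightarrow> balance x = 0 \<and> (\<forall>s<length x. balance (take s x) \<ge> 0) \<and> tops 3 x = {} \<and> tops 4 x = {}"

definition items :: "nat list list \<Rightarrow> nat list" where
  "items xs = concat (map (\<lambda>x. x @ [4]) xs)"

lemma items_Nil [simp]: "items [] = []"
  and items_Cons [simp]: "items (x # xs) = x @ 4 # items xs"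
  and items_append [simp]: "items (xs @ ys) = items xs @ items ys"
  by (simp_all add: items_def)

lemma enc_seq_items: "enc_seq xs = 2 # items xs @ [3]"
  by (simp add: enc_seq_def items_def)

lemma tops_append_subset: "tops a u \<subseteq> tops a (u @ v)"
  by (auto simp: tops_def nth_append)

lemma tops_single: "tops a [b] = (if a = b then {0} else {})"
  by (auto simp: tops_def)

lemma card_tops_item:
  assumes "balance x = 0"
  shows "card (tops a (x @ 4 # y)) = card (tops a x) + (if a = 4 then 1 else 0) + card (tops a y)"
proof -
  have "card (tops a ([4] @ y)) = card (tops a [4]) + card (tops a y)"
    by (rule card_tops_append) (simp add: balance_Cons)
  then show ?thesis by (simp add: card_tops_append[OF assms] tops_single)
qed

lemma item_prefix_items: "\<forall>x\<in>set xs. clean x \<Longrightarrow> item_prefix (length xs) (items xs)"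
proof (induction xs)
  case Nil
  show ?case by (simp add: item_prefix_def)
next
  case (Cons x xs)
  then have IH: "balance (items xs) = 0" "card (tops 4 (items xs)) = length xs" "tops 3 (items xs) = {}"
    and x: "balance x = 0" "tops 3 x = {}" "tops 4 x = {}"
    by (simp_all add: item_prefix_def clean_def)
  show ?case
    using IH x card_tops_item[OF x(1), of _ "items xs"]
    by (simp add: item_prefix_def balance_Cons flip: card_0_eq)
qed

text \<open>The excluded letters are those that can follow a complete item or the complete sequence,
  so the place before \<open>a\<close> must lie within an item.\<close>

lemma item_prefixD:
  assumes "\<forall>x\<in>set xs. clean x" "u @ a # v = items xs @ 3 # rest" "item_prefix i u" "a \<noteq> 3" "a \<noteq> 4"
  shows "i < length xs \<and> (\<exists>u' v'. xs ! i = u' @ a # v' \<and> balance u' = 0 \<and> u = items (take i xs) @ u')"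
  using assms
proof (induction xs arbitrary: u i)
  case Nil
  show ?case
  proof (cases u)
    case (Cons b u1)
    then have "b = 3" using Nil by simp
    then have "0 \<in> tops 3 u" using Cons by (simp add: tops_def)
    then show ?thesis using Nil by (simp add: item_prefix_def)
  qed (use Nil in simp)
next
  case (Cons x xs)
  have x: "balance x = 0" "tops 3 x = {}" "tops 4 x = {}"
    using Cons.prems(1) by (simp_all add: clean_def)
  from Cons.prems(2) have "u @ (a # v) = x @ (4 # items xs @ 3 # rest)" by simp
  then consider (inside) y where "x = u @ y" "a # v = y @ 4 # items xs @ 3 # rest"
    | (outside) y where "u = x @ y" "y @ a # v = 4 # items xs @ 3 # rest"
    unfolding append_eq_append_conv2 by metis
  then show ?case
  proof cases
    case inside
    then obtain y' where y: "y = a # y'" using Cons.prems(5) by (cases y) auto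
    have "tops 4 u = {}" using tops_append_subset[of 4 u y] x(3) inside(1) by simp
    then have "i = 0" using Cons.prems(3) by (simp add: item_prefix_def)
    then show ?thesis using inside y Cons.prems(3) by (simp add: item_prefix_def)
  next
    case outside
    then obtain y' where y: "y = 4 # y'" "y' @ a # v = items xs @ 3 # rest"
      using Cons.prems(5) by (cases y) auto
    have u: "u = x @ 4 # y'" using outside(1) y(1) by simp
    have i: "i = Suc (card (tops 4 y'))" and 3: "tops 3 y' = {}" and bal: "balance y' = 0"
      using card_tops_item[OF x(1), of _ y'] Cons.prems(3) x u
      by (simp_all add: item_prefix_def balance_Cons flip: card_0_eq)
    have "card (tops 4 y') < length xs \<and>
      (\<exists>u' v'. xs ! card (tops 4 y') = u' @ a # v' \<and> balance u' = 0 \<and> y' = items (take (card (tops 4 y')) xs) @ u')"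
      using Cons.prems(1,4,5) y(2) 3 bal by (intro Cons.IH) (simp_all add: item_prefix_def)
    then show ?thesis using i u by auto
  qed
qed

lemma balance_take_items: "\<forall>x\<in>set xs. clean x \<Longrightarrow> balance (take s (items xs)) \<ge> 0"
proof (induction xs arbitrary: s)
  case (Cons x xs)
  have x: "balance x = 0" "\<forall>s<length x. balance (take s x) \<ge> 0"
    using Cons.prems by (simp_all add: clean_def)
  show ?case
  proof (cases "s < length x")
    case True
    then show ?thesis using x(2) by simp
  next
    case False
    show ?thesis
    proof (cases "s - length x")
      case (Suc r)
      have "balance (take r (items xs)) \<ge> 0" using Cons.prems by (intro Cons.IH) simp
      then show ?thesis using False Suc x by (simp add: balance_Cons)
    qed (use False x in simp)
  qed
qed simp

text \<open>The outer bracket is still open and the items before the cut contribute at least 0. So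
  nothing strictly inside an encoded sequence looks like top level to the text around it.\<close>

lemma balance_take_enc_seq:
  assumes "\<forall>x\<in>set xs. clean x" "0 < s" "s < length (enc_seq xs)"
  shows "balance (take s (enc_seq xs)) > 0"
proof -
  obtain r where r: "s = Suc r" using assms(2) by (cases s) auto
  then have "r \<le> length (items xs)" using assms(3) by (simp add: enc_seq_items)
  then have "take s (enc_seq xs) = 2 # take r (items xs)" by (simp add: r enc_seq_items)
  then show ?thesis using balance_take_items[OF assms(1), of r] by (simp add: balance_Cons)
qed

lemma clean_enc_seq:
  assumes "\<forall>x\<in>set xs. clean x"
  shows "clean (enc_seq xs)"
proof -
  have pos: "balance (take s (enc_seq xs)) > 0" if "s < length (enc_seq xs)" "s \<noteq> 0" for s
    using balance_take_enc_seq[OF assms, of s] that by simp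
  have "balance (take s (enc_seq xs)) \<ge> 0" if "s < length (enc_seq xs)" for s
    using pos[OF that] by (cases "s = 0") simp_all
  moreover have "tops a (enc_seq xs) = {}" if "a \<noteq> 2" for a
  proof -
    have "enc_seq xs ! s \<noteq> a \<or> balance (take s (enc_seq xs)) \<noteq> 0" if "s < length (enc_seq xs)" for s
      using pos[OF that] \<open>a \<noteq> 2\<close> by (cases "s = 0") (simp_all add: enc_seq_items)
    then show ?thesis by (auto simp: tops_def)
  qed
  moreover have "balance (enc_seq xs) = 0"
    using item_prefix_items[OF assms] by (simp add: item_prefix_def enc_seq_items balance_Cons)
  ultimately show ?thesis by (simp add: clean_def)
qed

section \<open>Trees, their encodings and paths in them\<close>

datatype tree = Leaf "nat list" | Node "tree list"

fun enc :: "tree \<Rightarrow> nat list" where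
  "enc (Leaf x) = x"
| "enc (Node ts) = enc_seq (map enc ts)"

fun bits_only :: "tree \<Rightarrow> bool" where
  "bits_only (Leaf x) \<longleftrightarrow> set x \<subseteq> {0, 1}"
| "bits_only (Node ts) \<longleftrightarrow> (\<forall>t\<in>set ts. bits_only t)"

lemma clean_enc: "bits_only t \<Longrightarrow> clean (enc t)"
proof (induction t)
  case (Leaf x)
  then have no: "a \<notin> set x" if "a = 2 \<or> a = 3 \<or> a = 4" for a using that by auto
  have "balance (take s x) = 0" for s
    using no by (intro balance_no_brackets) (auto dest: in_set_takeD)
  moreover have "tops a x = {}" if "a = 3 \<or> a = 4" for a
    using no[of a] that nth_mem by (auto simp: tops_def)
  ultimately show ?case
    using balance_no_brackets[of x] no by (auto simp: clean_def)
next
  case (Node ts)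
  then have "\<forall>x\<in>set (map enc ts). clean x" by simp
  then show ?case by (simp add: clean_enc_seq)
qed

lemma set_enc_seq: "\<forall>x\<in>set xs. set x \<subseteq> {..<5} \<Longrightarrow> set (enc_seq xs) \<subseteq> {..<5}"
  by (auto simp: enc_seq_def)

lemma set_enc: "bits_only t \<Longrightarrow> set (enc t) \<subseteq> {..<5}"
proof (induction t)
  case (Node ts)
  then have "\<forall>x\<in>set (map enc ts). set x \<subseteq> {..<5}" by simp
  then show ?case by (simp add: set_enc_seq)
qed auto

fun subtree :: "tree \<Rightarrow> nat list \<Rightarrow> tree option" where
  "subtree t [] = Some t"
| "subtree (Leaf x) (i # is) = None"
| "subtree (Node ts) (i # is) = (if i < length ts then subtree (ts ! i) is else None)"

lemma subtree_append: "subtree t (is @ js) = Option.bind (subtree t is) (\<lambda>t'. subtree t' js)"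
  by (induction t "is" rule: subtree.induct) auto

definition occurs_at :: "nat list \<Rightarrow> tree \<Rightarrow> nat \<Rightarrow> bool" where
  "occurs_at w t p \<longleftrightarrow> (\<exists>pre post. w = pre @ enc t @ post \<and> p = length pre)"

text \<open>Positions strictly between the opening bracket at q and p are inspected, so p may be the start of
  item i of the sequence opened at q.  No balanced closing bracket may precede p, since it would end
  this sequence.\<close>

definition Bal :: "nat list \<Rightarrow> nat \<Rightarrow> nat \<Rightarrow> bool" where
  "Bal w q p \<longleftrightarrow> card {s. s < length w \<and> q < s \<and> s < p \<and> w ! s = 2}
    = card {s. s < length w \<and> q < s \<and> s < p \<and> w ! s = 3}"

definition Item :: "nat list \<Rightarrow> nat \<Rightarrow> nat \<Rightarrow> nat \<Rightarrow> bool" where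
  "Item w q i p \<longleftrightarrow> q < p \<and> Bal w q p
    \<and> i = card {s. s < length w \<and> q < s \<and> s < p \<and> w ! s = 4 \<and> Bal w q s}
    \<and> \<not> (\<exists>s<length w. q < s \<and> s < p \<and> w ! s = 3 \<and> Bal w q s)"

text \<open>The bound on \<open>i\<close> anticipates the formula, where an index is a quantified
  variable and hence a position of the word.\<close>

primrec Path :: "nat list \<Rightarrow> nat \<Rightarrow> nat list \<Rightarrow> nat \<Rightarrow> bool" where
  "Path w q [] p \<longleftrightarrow> p = q"
| "Path w q (i # is) p \<longleftrightarrow>
    i < length w \<and> (\<exists>p'<length w. Item w q i p' \<and> w ! p' = 2 \<and> Path w p' is p)"

definition Bit :: "nat list \<Rightarrow> nat list \<Rightarrow> nat \<Rightarrow> bool" where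
  "Bit w is i \<longleftrightarrow> i < length w \<and>
    (\<exists>p<length w. Path w 0 is p \<and> (\<exists>p'<length w. Item w p i p' \<and> w ! p' = 1))"

text \<open>Position \<open>p\<close> is the letter before the number, a bracket or a comma; so the
  second end of an edge can be read from the comma \<open>r\<close> that ends the first.\<close>

definition Num :: "nat list \<Rightarrow> nat \<Rightarrow> nat \<Rightarrow> nat \<Rightarrow> bool" where
  "Num w p r a \<longleftrightarrow> p < r \<and> r < length w \<and> w ! r = 4
    \<and> a = card {s. s < length w \<and> p < s \<and> s < r}
    \<and> \<not> (\<exists>s<length w. p < s \<and> s < r \<and> w ! s \<noteq> 1)"

definition Edge :: "nat list \<Rightarrow> nat list \<Rightarrow> nat \<Rightarrow> nat \<Rightarrow> bool" where
  "Edge w is a b \<longleftrightarrow> (\<exists>j<length w. \<exists>p<length w. Path w 0 (is @ [j]) p \<and>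
    (\<exists>r<length w. Num w p r a \<and> (\<exists>s<length w. Num w r s b)))"

lemma segment_eq:
  assumes "w = pre @ b # u @ v"
  shows "{s. s < length w \<and> length pre < s \<and> s < Suc (length pre + length u) \<and> R s}
    = (\<lambda>s. Suc (length pre + s)) ` {s. s < length u \<and> R (Suc (length pre + s))}" (is "?A = ?f ` ?B")
proof
  show "?A \<subseteq> ?f ` ?B"
  proof
    fix s assume s: "s \<in> ?A"
    then have "s = ?f (s - Suc (length pre))" by simp
    moreover have "s - Suc (length pre) \<in> ?B" using s by auto
    ultimately show "s \<in> ?f ` ?B" by blast
  qed
  show "?f ` ?B \<subseteq> ?A" using assms by auto
qed

lemma card_segment:
  assumes "w = pre @ b # u @ v"
  shows "card {s. s < length w \<and> length pre < s \<and> s < Suc (length pre + length u) \<and> R s}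
    = card {s. s < length u \<and> R (Suc (length pre + s))}"
  unfolding segment_eq[OF assms] by (rule card_image) (simp add: inj_on_def)

lemma Bal_iff:
  assumes "w = pre @ b # u @ v"
  shows "Bal w (length pre) (Suc (length pre + length u)) \<longleftrightarrow> balance u = 0"
proof -
  have "card {s. s < length u \<and> w ! Suc (length pre + s) = a} = count_list u a" for a
  proof -
    have "{s. s < length u \<and> w ! Suc (length pre + s) = a} = {s. s < length u \<and> a = u ! s}"
      using assms by (auto simp: nth_append)
    then show ?thesis by (simp add: count_list_eq_length_filter length_filter_conv_card)
  qed
  then show ?thesis by (simp add: Bal_def card_segment[OF assms] balance_def)
qed

lemma Item_iff:
  assumes "w = pre @ b # u @ v"
  shows "Item w (length pre) i (Suc (length pre + length u)) \<longleftrightarrow> item_prefix i u"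
proof -
  have bal: "Bal w (length pre) (Suc (length pre + s)) \<longleftrightarrow> balance (take s u) = 0" if "s < length u" for s
    using Bal_iff[of w pre b "take s u" "drop s u @ v"] assms that by simp
  have nth: "w ! Suc (length pre + s) = u ! s" if "s < length u" for s
    using assms that by (simp add: nth_append)
  have tops: "{s. s < length u \<and> w ! Suc (length pre + s) = a \<and> Bal w (length pre) (Suc (length pre + s))} = tops a u" for a
    using bal nth by (auto simp: tops_def)
  let ?top = "\<lambda>a. {s. s < length w \<and> length pre < s \<and> s < Suc (length pre + length u)
    \<and> w ! s = a \<and> Bal w (length pre) s}"
  have image: "?top a = (\<lambda>s. Suc (length pre + s)) ` tops a u" for a
    using segment_eq[OF assms, of "\<lambda>s. w ! s = a \<and> Bal w (length pre) s"] tops[of a] by simp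
  have "card (?top 4) = card (tops 4 u)"
    unfolding image by (rule card_image) (simp add: inj_on_def)
  moreover have "(\<exists>s<length w. length pre < s \<and> s < Suc (length pre + length u) \<and> w ! s = 3 \<and> Bal w (length pre) s)
      \<longleftrightarrow> tops 3 u \<noteq> {}"
  proof -
    have "?top 3 \<noteq> {} \<longleftrightarrow> tops 3 u \<noteq> {}" unfolding image by simp
    then show ?thesis by blast
  qed
  ultimately show ?thesis
    unfolding Item_def item_prefix_def Bal_iff[OF assms] by auto
qed

text \<open>The text \<open>post\<close> is arbitrary, but a position in it is ruled out: the
  closing bracket of the sequence would be a balanced one before it.\<close>

lemma Item_soundD:
  assumes w: "w = pre @ enc_seq xs @ post" and xs: "\<forall>x\<in>set xs. clean x"
    and p: "Item w (length pre) i p" "p < length w" "w ! p = a" "a \<noteq> 3" "a \<noteq> 4"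
  shows "i < length xs \<and> (\<exists>u' v'. xs ! i = u' @ a # v' \<and> balance u' = 0
    \<and> p = Suc (length pre + length (items (take i xs)) + length u'))"
proof -
  define z where "z = items xs @ 3 # post"
  have wz: "w = pre @ 2 # z" using w by (simp add: enc_seq_items z_def)
  have "length pre < p" using p(1) by (simp add: Item_def)
  then obtain k where k: "p = Suc (length pre + k)" using less_imp_Suc_add by blast
  have kz: "k < length z" using p(2) k wz by simp
  define u v where "u = take k z" and "v = drop (Suc k) z"
  have "z ! k = a" using p(3) k wz by (simp add: nth_append)
  then have z: "u @ a # v = z" using kz unfolding u_def v_def by (metis id_take_nth_drop)
  have lu: "length u = k" using kz by (simp add: u_def)
  have "item_prefix i u"
    using Item_iff[of w pre 2 u "a # v" i] wz z p(1) k lu by simp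
  then have "i < length xs \<and> (\<exists>u' v'. xs ! i = u' @ a # v' \<and> balance u' = 0 \<and> u = items (take i xs) @ u')"
    using item_prefixD[OF xs, of u a v post i] z p(4,5) by (simp add: z_def)
  then show ?thesis using k lu by auto
qed

lemma items_split:
  assumes "i < length xs"
  shows "pre @ enc_seq xs @ post
    = (pre @ 2 # items (take i xs)) @ xs ! i @ (4 # items (drop (Suc i) xs) @ 3 # post)"
proof -
  have "items xs = items (take i xs @ xs ! i # drop (Suc i) xs)"
    using id_take_nth_drop[OF assms] by simp
  then show ?thesis by (simp add: enc_seq_items)
qed

lemma Item_complete:
  assumes w: "w = pre @ enc_seq xs @ post" and xs: "\<forall>x\<in>set xs. clean x"
    and i: "i < length xs" "xs ! i = a # v'"
  defines "p \<equiv> Suc (length pre + length (items (take i xs)))"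
  shows "Item w (length pre) i p \<and> p < length w \<and> w ! p = a"
proof -
  have w': "w = pre @ 2 # items (take i xs) @ a # v' @ (4 # items (drop (Suc i) xs) @ 3 # post)"
    using w items_split[OF i(1)] i(2) by simp
  have "\<forall>x\<in>set (take i xs). clean x" using xs by (auto dest: in_set_takeD)
  from item_prefix_items[OF this] have "item_prefix i (items (take i xs))" using i(1) by simp
  with Item_iff[OF w', of i] have "Item w (length pre) i p" by (simp add: p_def)
  moreover have "p < length w" "w ! p = a" using w' by (simp_all add: p_def nth_append)
  ultimately show ?thesis by simp
qed

lemma clean_map_enc: "bits_only (Node ts) \<Longrightarrow> \<forall>x\<in>set (map enc ts). clean x"
  by (simp add: clean_enc)

lemma length_le_length_items: "length xs \<le> length (items xs)"
  by (induction xs) simp_all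

lemma occurs_at_child:
  assumes "w = pre @ enc (Node ts) @ post" "i < length ts"
  shows "occurs_at w (ts ! i) (Suc (length pre + length (items (take i (map enc ts)))))"
  unfolding occurs_at_def
  using items_split[of i "map enc ts" pre post] assms
  by (intro exI[of _ "pre @ 2 # items (take i (map enc ts))"]
      exI[of _ "4 # items (drop (Suc i) (map enc ts)) @ 3 # post"]) simp

lemma occurs_at_bounds:
  assumes "occurs_at w (Node ts) q"
  shows "q < length w" "i < length ts \<Longrightarrow> i < length w"
  using assms length_le_length_items[of "map enc ts"]
  by (auto simp: occurs_at_def enc_seq_items)

lemma Item_childD:
  assumes "occurs_at w (Node ts) q" "bits_only (Node ts)" "Item w q i p" "p < length w" "w ! p = 2"
  shows "i < length ts \<and> (\<exists>ts'. ts ! i = Node ts' \<and> occurs_at w (Node ts') p)"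
proof -
  obtain pre post where w: "w = pre @ enc (Node ts) @ post" "q = length pre"
    using assms(1) by (auto simp: occurs_at_def)
  obtain u' v' where i: "i < length ts" and uv: "enc (ts ! i) = u' @ 2 # v'" "balance u' = 0"
    and p: "p = Suc (length pre + length (items (take i (map enc ts))) + length u')"
    using Item_soundD[of w pre "map enc ts" post i p 2] clean_map_enc[OF assms(2)] assms(3-5) w by auto
  have "bits_only (ts ! i)" using assms(2) i by simp
  then obtain ts' where ts': "ts ! i = Node ts'" "bits_only (Node ts')"
    using uv(1) by (cases "ts ! i") auto
  \<comment> \<open>Inside an item that is a sequence the balance stays positive, so a balanced
    place before an opening bracket can only be its start.\<close>
  have "u' = []"
  proof (rule ccontr)
    assume "u' \<noteq> []"
    moreover have "length u' < length (enc_seq (map enc ts'))" "take (length u') (enc_seq (map enc ts')) = u'"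
      using uv(1) ts'(1) by simp_all
    ultimately show False
      using balance_take_enc_seq[OF clean_map_enc[OF ts'(2)], of "length u'"] uv(2) by simp
  qed
  then show ?thesis using occurs_at_child[OF w(1) i] i ts'(1) p by simp
qed

lemma Item_child:
  assumes "occurs_at w (Node ts) q" "bits_only (Node ts)" "i < length ts" "ts ! i = Node ts'"
  shows "\<exists>p<length w. Item w q i p \<and> w ! p = 2 \<and> occurs_at w (Node ts') p"
proof -
  obtain pre post where w: "w = pre @ enc (Node ts) @ post" "q = length pre"
    using assms(1) by (auto simp: occurs_at_def)
  have "map enc ts ! i = 2 # items (map enc ts') @ [3]" using assms(3,4) by (simp add: enc_seq_items)
  from Item_complete[OF _ clean_map_enc[OF assms(2)] _ this, of w pre post] w assms(3)
  have "Item w q i (Suc (length pre + length (items (take i (map enc ts)))))"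
    "Suc (length pre + length (items (take i (map enc ts)))) < length w"
    "w ! Suc (length pre + length (items (take i (map enc ts)))) = 2"
    by simp_all
  with occurs_at_child[OF w(1) assms(3)] assms(4) show ?thesis by metis
qed

lemma Path_soundD:
  assumes "occurs_at w (Node ts) q" "bits_only (Node ts)" "Path w q is p"
  shows "\<exists>ts'. subtree (Node ts) is = Some (Node ts') \<and> occurs_at w (Node ts') p \<and> bits_only (Node ts')"
  using assms
proof (induction "is" arbitrary: ts q)
  case (Cons i "is")
  then obtain p' where p': "p' < length w" "Item w q i p'" "w ! p' = 2" "Path w p' is p" by auto
  then obtain ts' where ts': "i < length ts" "ts ! i = Node ts'" "occurs_at w (Node ts') p'"
    using Item_childD[OF Cons.prems(1,2)] by blast
  have "bits_only (Node ts')" using Cons.prems(2) ts'(1,2) by (metis bits_only.simps(2) nth_mem)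
  from Cons.IH[OF ts'(3) this p'(4)] ts' show ?case by simp
qed simp

lemma Path_complete:
  assumes "occurs_at w (Node ts) q" "bits_only (Node ts)" "subtree (Node ts) is = Some (Node ts')"
  shows "\<exists>p. Path w q is p \<and> occurs_at w (Node ts') p"
  using assms
proof (induction "is" arbitrary: ts q)
  case (Cons i "is")
  then have i: "i < length ts" "subtree (ts ! i) is = Some (Node ts')" by (auto split: if_splits)
  obtain us where us: "ts ! i = Node us"
  proof (cases "ts ! i")
    case (Leaf x)
    then show ?thesis using i(2) by (cases "is") auto
  qed
  obtain p' where p': "p' < length w" "Item w q i p'" "w ! p' = 2" "occurs_at w (Node us) p'"
    using Item_child[OF Cons.prems(1,2) i(1) us] by blast
  have "bits_only (Node us)" using Cons.prems(2) i(1) us by (metis bits_only.simps(2) nth_mem)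
  from Cons.IH[OF p'(4) this] i(2) us obtain p where "Path w p' is p" "occurs_at w (Node ts') p" by auto
  moreover have "i < length w" using occurs_at_bounds(2)[OF Cons.prems(1) i(1)] .
  ultimately show ?case using p' by auto
qed simp

section \<open>Reading tables and edges from an encoded tree\<close>

definition bits_tree :: "bool list \<Rightarrow> tree" where
  "bits_tree bs = Node (map (\<lambda>b. Leaf [if b then 1 else 0]) bs)"

definition edges_tree :: "(nat \<times> nat) list \<Rightarrow> tree" where
  "edges_tree es = Node (map (\<lambda>e. Node [Leaf (replicate (fst e) 1), Leaf (replicate (snd e) 1)]) es)"

lemma Num_iff:
  assumes v: "v = pre @ b # replicate n 1 @ 4 # post"
  shows "Num v (length pre) r a \<longleftrightarrow> r = Suc (length pre + n) \<and> a = n"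
proof -
  have ones: "v ! s = 1" if "length pre < s" "s < Suc (length pre + n)" for s
  proof -
    obtain k where "s = Suc (length pre + k)" using \<open>length pre < s\<close> less_imp_Suc_add by blast
    then show ?thesis using that v by (simp add: nth_append)
  qed
  have four: "v ! Suc (length pre + n) = 4" and len: "Suc (length pre + n) < length v"
    using v by (simp_all add: nth_append)
  have "r = Suc (length pre + n)" if "Num v (length pre) r a"
  proof (rule ccontr)
    assume "r \<noteq> Suc (length pre + n)"
    then consider "r < Suc (length pre + n)" | "Suc (length pre + n) < r" by linarith
    then show False
    proof cases
      case 1
      then show False using that ones[of r] by (simp add: Num_def)
    next
      case 2
      then show False using that four len by (auto simp: Num_def)
    qed
  qed
  moreover have "{s. s < length v \<and> length pre < s \<and> s < Suc (length pre + n)} = {length pre<..<Suc (length pre + n)}"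
    using len by auto
  then have "Num v (length pre) (Suc (length pre + n)) a \<longleftrightarrow> a = n"
    using ones four len by (auto simp: Num_def)
  ultimately show ?thesis by auto
qed

context
  fixes w :: "nat list" and ts :: "tree list"
  assumes w: "w = enc (Node ts)" and bits: "bits_only (Node ts)"
begin

lemma occurs_at_root: "occurs_at w (Node ts) 0"
  using w by (auto simp: occurs_at_def)

text \<open>Formulas address \<open>K\<close> layers in every instance; the table of an absent one
  reads as false.\<close>

lemma not_Bit:
  assumes "subtree (Node ts) is = None"
  shows "\<not> Bit w is i"
proof
  assume "Bit w is i"
  then obtain p where "Path w 0 is p" unfolding Bit_def by blast
  from Path_soundD[OF occurs_at_root bits this] assms show False by simp
qed

lemma Bit_iff:
  assumes "subtree (Node ts) is = Some (bits_tree bs)"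
  shows "Bit w is i \<longleftrightarrow> i < length bs \<and> bs ! i"
proof
  let ?ts = "map (\<lambda>b. Leaf [if b then 1 else 0]) bs"
  have "bits_only (Node ?ts)" by simp
  then have clean: "\<forall>x\<in>set (map enc ?ts). clean x" by (rule clean_map_enc)
  {
    assume "Bit w is i"
    then obtain p p' where p: "Path w 0 is p" "p' < length w" "Item w p i p'" "w ! p' = 1"
      by (auto simp: Bit_def)
    have "occurs_at w (Node ?ts) p"
      using Path_soundD[OF occurs_at_root bits p(1)] assms by (auto simp: bits_tree_def)
    then obtain pre post where "w = pre @ enc_seq (map enc ?ts) @ post" "p = length pre"
      by (auto simp: occurs_at_def)
    from Item_soundD[OF this(1) clean, of i p' 1] this(2) p
    obtain u' v' where i: "i < length bs" and "enc (Leaf [if bs ! i then 1 else 0]) = u' @ 1 # v'" by auto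
    then have "(if bs ! i then 1 else 0) = (1::nat)" by (cases u') auto
    then show "i < length bs \<and> bs ! i" using i by (simp split: if_splits)
  }
  assume i: "i < length bs \<and> bs ! i"
  obtain p where p: "Path w 0 is p" "occurs_at w (Node ?ts) p"
    using Path_complete[OF occurs_at_root bits] assms by (auto simp: bits_tree_def)
  obtain pre post where "w = pre @ enc_seq (map enc ?ts) @ post" "p = length pre"
    using p(2) by (auto simp: occurs_at_def)
  from Item_complete[OF this(1) clean, of i 1 "[]"] this(2) i
  have "\<exists>p'<length w. Item w p i p' \<and> w ! p' = 1" by auto
  moreover have "p < length w" using occurs_at_bounds(1)[OF p(2)] .
  moreover have "i < length w" using occurs_at_bounds(2)[OF p(2), of i] i by simp
  ultimately show "Bit w is i" using p(1) unfolding Bit_def by blast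
qed

lemma not_Edge:
  assumes "subtree (Node ts) is = None"
  shows "\<not> Edge w is a b"
proof
  assume "Edge w is a b"
  then obtain j p where "Path w 0 (is @ [j]) p" unfolding Edge_def by blast
  from Path_soundD[OF occurs_at_root bits this] assms show False by (simp add: subtree_append)
qed

lemma Edge_iff:
  assumes "subtree (Node ts) is = Some (edges_tree es)"
  shows "Edge w is a b \<longleftrightarrow> (a, b) \<in> set es"
proof -
  let ?e = "\<lambda>e :: nat \<times> nat. [Leaf (replicate (fst e) 1), Leaf (replicate (snd e) 1)]"
  have sub: "subtree (Node ts) (is @ [j]) = (if j < length es then Some (Node (?e (es ! j))) else None)" for j
    using assms by (simp add: subtree_append edges_tree_def)
  have num: "(\<exists>r<length w. Num w p r a \<and> (\<exists>s<length w. Num w r s b)) \<longleftrightarrow> (a, b) = e"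
    if at: "occurs_at w (Node (?e e)) p" for p e
  proof -
    obtain pre post where w': "w = pre @ enc (Node (?e e)) @ post" "p = length pre"
      using at by (auto simp: occurs_at_def)
    have 1: "w = pre @ 2 # replicate (fst e) 1 @ 4 # (replicate (snd e) 1 @ 4 # 3 # post)"
      using w'(1) by (simp add: enc_seq_items)
    have 2: "w = (pre @ 2 # replicate (fst e) 1) @ 4 # replicate (snd e) 1 @ 4 # 3 # post"
      using w'(1) by (simp add: enc_seq_items)
    have "Num w (Suc (length pre + fst e)) s b \<longleftrightarrow> s = Suc (Suc (length pre + fst e) + snd e) \<and> b = snd e" for s
      using Num_iff[OF 2, of s b] by simp
    moreover have "Suc (Suc (length pre + fst e) + snd e) < length w" using 1 by simp
    ultimately show ?thesis using Num_iff[OF 1, of _ a] w'(2) by (cases e) auto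
  qed
  show ?thesis
  proof
    assume "Edge w is a b"
    then obtain j p where jp: "Path w 0 (is @ [j]) p"
      "\<exists>r<length w. Num w p r a \<and> (\<exists>s<length w. Num w r s b)" unfolding Edge_def by blast
    from Path_soundD[OF occurs_at_root bits jp(1)] sub[of j]
    have "j < length es" "occurs_at w (Node (?e (es ! j))) p" by (auto split: if_splits)
    with num jp(2) show "(a, b) \<in> set es" by (metis nth_mem)
  next
    assume "(a, b) \<in> set es"
    then obtain j where j: "j < length es" "es ! j = (a, b)" by (auto simp: in_set_conv_nth)
    then have sj: "subtree (Node ts) (is @ [j]) = Some (Node (?e (a, b)))" using sub by simp
    obtain p where p: "Path w 0 (is @ [j]) p" "occurs_at w (Node (?e (a, b))) p"
      using Path_complete[OF occurs_at_root bits sj] by blast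
    obtain q where "occurs_at w (edges_tree es) q"
      using Path_complete[OF occurs_at_root bits] assms unfolding edges_tree_def by blast
    then have "j < length w"
      unfolding edges_tree_def using occurs_at_bounds(2) j(1) by simp
    moreover have "p < length w" using occurs_at_bounds(1)[OF p(2)] .
    ultimately show "Edge w is a b" unfolding Edge_def using p num[of "(a, b)" p] by blast
  qed
qed

end

section \<open>The defining formula\<close>

definition Or :: "fm \<Rightarrow> fm \<Rightarrow> fm" where
  "Or \<phi> \<psi> = Neg (And (Neg \<phi>) (Neg \<psi>))"

text \<open>Variable 0 has value 0, so this denies that the number of witnesses is 0.\<close>

definition Exists :: "fm \<Rightarrow> fm" where
  "Exists \<phi> = Neg (Count 0 \<phi>)"

definition Eq :: "nat \<Rightarrow> nat \<Rightarrow> fm" where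
  "Eq x y = And (Neg (Less x y)) (Neg (Less y x))"

definition env_ok :: "nat \<Rightarrow> nat list \<Rightarrow> (nat \<Rightarrow> nat) \<Rightarrow> bool" where
  "env_ok m w \<rho> \<longleftrightarrow> 0 < m \<and> \<rho> 0 = 0 \<and> w \<noteq> []"

lemma env_ok_upd [simp]: "env_ok m w \<rho> \<Longrightarrow> env_ok (Suc m) w (\<rho>(m := x))"
  by (simp add: env_ok_def)

lemma eval_Or [simp]: "eval m (Or \<phi> \<psi>) w \<rho> \<longleftrightarrow> eval m \<phi> w \<rho> \<or> eval m \<psi> w \<rho>"
  by (simp add: Or_def)

lemma eval_Exists [simp]:
  "env_ok m w \<rho> \<Longrightarrow> eval m (Exists \<phi>) w \<rho> \<longleftrightarrow> (\<exists>x<length w. eval (Suc m) \<phi> w (\<rho>(m := x)))"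
  by (auto simp: Exists_def env_ok_def)

lemma eval_Eq [simp]: "x < m \<Longrightarrow> y < m \<Longrightarrow> eval m (Eq x y) w \<rho> \<longleftrightarrow> \<rho> x = \<rho> y"
  by (auto simp: Eq_def)

definition fBal :: "nat \<Rightarrow> nat \<Rightarrow> nat \<Rightarrow> fm" where
  "fBal m q p =
    (let count = (\<lambda>a. Count m (And (Less q (Suc m)) (And (Less (Suc m) p) (Letter a (Suc m)))))
     in Exists (And (count 2) (count 3)))"

definition fItem :: "nat \<Rightarrow> nat \<Rightarrow> nat \<Rightarrow> nat \<Rightarrow> fm" where
  "fItem m q i p =
    (let top = (\<lambda>a. And (Less q m) (And (Less m p) (And (Letter a m) (fBal (Suc m) q m))))
     in And (Less q p) (And (fBal m q p) (And (Count i (top 4)) (Neg (Exists (top 3))))))"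

text \<open>Position 0 is always left out, so such a count is itself a position. This lets
  \<open>fBal\<close> name the common number of brackets by a quantified variable.\<close>

lemma card_inside_less:
  assumes "w \<noteq> []"
  shows "card {s. s < length w \<and> (q::nat) < s \<and> R s} < length w"
proof -
  have "{s. s < length w \<and> q < s \<and> R s} \<subset> {..<length w}" using assms by auto
  from psubset_card_mono[OF _ this] show ?thesis by simp
qed

lemma eval_fBal [simp]:
  assumes "env_ok m w \<rho>" "q < m" "p < m"
  shows "eval m (fBal m q p) w \<rho> \<longleftrightarrow> Bal w (\<rho> q) (\<rho> p)"
proof -
  have "eval m (fBal m q p) w \<rho> \<longleftrightarrow>
    (\<exists>x<length w. x = card {s. s < length w \<and> \<rho> q < s \<and> s < \<rho> p \<and> w ! s = 2} \<and>
      x = card {s. s < length w \<and> \<rho> q < s \<and> s < \<rho> p \<and> w ! s = 3})"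
    using assms by (simp add: fBal_def cong: conj_cong)
  also have "\<dots> \<longleftrightarrow> Bal w (\<rho> q) (\<rho> p)"
    using assms(1) card_inside_less[of w "\<rho> q"] by (auto simp: Bal_def env_ok_def)
  finally show ?thesis .
qed

lemma eval_fItem [simp]:
  assumes "env_ok m w \<rho>" "q < m" "i < m" "p < m"
  shows "eval m (fItem m q i p) w \<rho> \<longleftrightarrow> Item w (\<rho> q) (\<rho> i) (\<rho> p)"
  using assms by (simp add: fItem_def Item_def cong: conj_cong)

text \<open>Entries of a path: constants address systems, components and layers; variables address
  nodes, edges and table entries.\<close>

datatype trm = Var nat | Const nat

primrec val :: "(nat \<Rightarrow> nat) \<Rightarrow> trm \<Rightarrow> nat" where
  "val \<rho> (Var x) = \<rho> x"
| "val \<rho> (Const i) = i"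

primrec trm_ok :: "nat \<Rightarrow> trm \<Rightarrow> bool" where
  "trm_ok m (Var x) \<longleftrightarrow> x < m"
| "trm_ok m (Const i) \<longleftrightarrow> True"

lemma val_upd [simp]: "trm_ok m t \<Longrightarrow> val (\<rho>(m := x)) t = val \<rho> t"
  by (cases t) simp_all

lemma trm_ok_Suc [simp]: "trm_ok m t \<Longrightarrow> trm_ok (Suc m) t"
  by (cases t) simp_all

text \<open>In the formulas below, the first argument is the level at which they are used; variable 0 has
  value 0.\<close>

primrec fConst :: "nat \<Rightarrow> nat \<Rightarrow> nat \<Rightarrow> fm" where
  "fConst m 0 y = Neg (Less 0 y)" for m
| "fConst m (Suc i) y =
    Exists (And (fConst (Suc m) i m) (And (Less m y) (Neg (Exists (And (Less m (Suc m)) (Less (Suc m) y))))))"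

lemma eval_fConst:
  "env_ok m w \<rho> \<Longrightarrow> y < m \<Longrightarrow> \<rho> y < length w \<Longrightarrow> eval m (fConst m i y) w \<rho> \<longleftrightarrow> \<rho> y = i"
proof (induction i arbitrary: m \<rho> y)
  case 0
  then show ?case by (auto simp: env_ok_def)
next
  case (Suc i)
  have "eval m (fConst m (Suc i) y) w \<rho> \<longleftrightarrow>
    (\<exists>x<length w. x = i \<and> x < \<rho> y \<and> \<not> (\<exists>z<length w. x < z \<and> z < \<rho> y))"
    using Suc.prems by (simp add: Suc.IH[OF env_ok_upd[OF Suc.prems(1)]] cong: conj_cong)
  also have "\<dots> \<longleftrightarrow> \<rho> y = Suc i"
  proof
    assume "\<exists>x<length w. x = i \<and> x < \<rho> y \<and> \<not> (\<exists>z<length w. x < z \<and> z < \<rho> y)"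
    then have "i < \<rho> y" "\<not> Suc i < \<rho> y" using Suc.prems(3) by auto
    then show "\<rho> y = Suc i" by simp
  qed (use Suc.prems(3) in auto)
  finally show ?case .
qed

primrec fTerm :: "nat \<Rightarrow> trm \<Rightarrow> nat \<Rightarrow> fm" where
  "fTerm m (Var x) y = Eq x y"
| "fTerm m (Const i) y = fConst m i y"

lemma eval_fTerm [simp]:
  "env_ok m w \<rho> \<Longrightarrow> y < m \<Longrightarrow> \<rho> y < length w \<Longrightarrow> trm_ok m t \<Longrightarrow> eval m (fTerm m t y) w \<rho> \<longleftrightarrow> \<rho> y = val \<rho> t"
  by (cases t) (auto simp: eval_fConst)

primrec fPath :: "nat \<Rightarrow> nat \<Rightarrow> trm list \<Rightarrow> nat \<Rightarrow> fm" where
  "fPath m q [] p = Eq p q" for m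
| "fPath m q (t # ts) p =
    Exists (And (fTerm (Suc m) t m) (Exists (And (fItem (Suc (Suc m)) q m (Suc m))
      (And (Letter 2 (Suc m)) (fPath (Suc (Suc m)) (Suc m) ts p)))))"

lemma map_val_upd [simp]: "\<forall>t\<in>set ts. trm_ok m t \<Longrightarrow> map (val (\<rho>(m := x))) ts = map (val \<rho>) ts"
  by (induction ts) simp_all

lemma eval_fPath [simp]:
  "env_ok m w \<rho> \<Longrightarrow> q < m \<Longrightarrow> p < m \<Longrightarrow> \<forall>t\<in>set ts. trm_ok m t \<Longrightarrow>
    eval m (fPath m q ts p) w \<rho> \<longleftrightarrow> Path w (\<rho> q) (map (val \<rho>) ts) (\<rho> p)"
proof (induction ts arbitrary: m \<rho> q)
  case (Cons t ts)
  have IH: "eval (Suc (Suc m)) (fPath (Suc (Suc m)) (Suc m) ts p) w (\<rho>(m := x, Suc m := y))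
      \<longleftrightarrow> Path w y (map (val \<rho>) ts) (\<rho> p)" for x y
    using Cons.IH[of "Suc (Suc m)" "\<rho>(m := x, Suc m := y)" "Suc m"] Cons.prems
    by (simp del: fun_upd_apply add: fun_upd_same fun_upd_other)
  have "eval m (fPath m q (t # ts) p) w \<rho> \<longleftrightarrow>
    (\<exists>i<length w. i = val \<rho> t \<and> (\<exists>p'<length w. Item w (\<rho> q) i p' \<and> w ! p' = 2 \<and>
      Path w p' (map (val \<rho>) ts) (\<rho> p)))"
    \<comment> \<open>\<open>conj_cong\<close> supplies the range of the quantified variable, which
      the evaluation of \<open>fTerm\<close> assumes.\<close>
    using Cons.prems by (simp add: IH cong: conj_cong)
  then show ?case by auto
qed simp

definition fBit :: "nat \<Rightarrow> trm list \<Rightarrow> trm \<Rightarrow> fm" where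
  "fBit m ts t = Exists (And (fTerm (Suc m) t m) (Exists (And (fPath (Suc (Suc m)) 0 ts (Suc m))
    (Exists (And (fItem (Suc (Suc (Suc m))) (Suc m) m (Suc (Suc m))) (Letter 1 (Suc (Suc m))))))))"

lemma eval_fBit [simp]:
  assumes "env_ok m w \<rho>" "\<forall>t\<in>set ts. trm_ok m t" "trm_ok m t"
  shows "eval m (fBit m ts t) w \<rho> \<longleftrightarrow> Bit w (map (val \<rho>) ts) (val \<rho> t)"
proof -
  have "0 < m" "\<rho> 0 = 0" using assms(1) by (simp_all add: env_ok_def)
  then have "eval m (fBit m ts t) w \<rho> \<longleftrightarrow>
    (\<exists>i<length w. i = val \<rho> t \<and> (\<exists>p<length w. Path w 0 (map (val \<rho>) ts) p \<and>
      (\<exists>p'<length w. Item w p i p' \<and> w ! p' = 1)))"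
    using assms by (simp add: fBit_def cong: conj_cong)
  then show ?thesis by (auto simp: Bit_def)
qed

definition fNum :: "nat \<Rightarrow> nat \<Rightarrow> nat \<Rightarrow> nat \<Rightarrow> fm" where
  "fNum m p r a = And (Less p r) (And (Letter 4 r) (And (Count a (And (Less p m) (Less m r)))
    (Neg (Exists (And (Less p m) (And (Less m r) (Neg (Letter 1 m))))))))"

lemma eval_fNum [simp]:
  assumes "env_ok m w \<rho>" "p < m" "r < m" "a < m"
  shows "eval m (fNum m p r a) w \<rho> \<longleftrightarrow> Num w (\<rho> p) (\<rho> r) (\<rho> a)"
  using assms by (simp add: fNum_def Num_def cong: conj_cong)

definition fEdge :: "nat \<Rightarrow> trm list \<Rightarrow> nat \<Rightarrow> nat \<Rightarrow> fm" where
  "fEdge m ts a b = Exists (Exists (And (fPath (Suc (Suc m)) 0 (ts @ [Var m]) (Suc m))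
    (Exists (And (fNum (Suc (Suc (Suc m))) (Suc m) (Suc (Suc m)) a)
      (Exists (fNum (Suc (Suc (Suc (Suc m)))) (Suc (Suc m)) (Suc (Suc (Suc m))) b))))))"

lemma eval_fEdge [simp]:
  assumes "env_ok m w \<rho>" "\<forall>t\<in>set ts. trm_ok m t" "a < m" "b < m"
  shows "eval m (fEdge m ts a b) w \<rho> \<longleftrightarrow> Edge w (map (val \<rho>) ts) (\<rho> a) (\<rho> b)"
proof -
  have "0 < m" "\<rho> 0 = 0" using assms(1) by (simp_all add: env_ok_def)
  then show ?thesis
    using assms by (simp add: fEdge_def Edge_def ball_Un cong: conj_cong)
qed

section \<open>The output of a node as a formula\<close>

definition Nbr :: "nat list \<Rightarrow> nat \<Rightarrow> nat \<Rightarrow> nat \<Rightarrow> nat \<Rightarrow> bool" where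
  "Nbr w s i u v \<longleftrightarrow> u = v \<or> Edge w [Suc s, 0, i] u v \<or> Edge w [Suc s, 0, i] v u"

text \<open>Item 0 of an instance is the number of nodes, so system \<open>s\<close> is item
  \<open>Suc s\<close>; in it the items 0, 1, 2 are layers, symmetry tables and masters.\<close>

definition fNbr :: "nat \<Rightarrow> nat \<Rightarrow> nat \<Rightarrow> nat \<Rightarrow> nat \<Rightarrow> fm" where
  "fNbr m s i u v = Or (Eq u v)
    (Or (fEdge m [Const (Suc s), Const 0, Const i] u v) (fEdge m [Const (Suc s), Const 0, Const i] v u))"

lemma eval_fNbr [simp]:
  "env_ok m w \<rho> \<Longrightarrow> u < m \<Longrightarrow> v < m \<Longrightarrow> eval m (fNbr m s i u v) w \<rho> \<longleftrightarrow> Nbr w s i (\<rho> u) (\<rho> v)"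
  by (simp add: fNbr_def Nbr_def)

text \<open>The number whose binary digits say in which of the neighbourhoods (s, i) of v the node u lies.\<close>

primrec cell :: "nat list \<Rightarrow> nat \<Rightarrow> (nat \<times> nat) list \<Rightarrow> nat \<Rightarrow> nat \<Rightarrow> nat" where
  "cell w v [] acc u = acc"
| "cell w v (j # js) acc u = cell w v js (2 * acc + (if Nbr w (fst j) (snd j) u v then 1 else 0)) u"

lemma cell_less: "cell w v js acc u < 2 ^ length js * Suc acc"
proof (induction js arbitrary: acc)
  case (Cons j js)
  let ?acc = "2 * acc + (if Nbr w (fst j) (snd j) u v then 1 else 0)"
  have "cell w v js ?acc u < 2 ^ length js * Suc ?acc" by (rule Cons.IH)
  also have "\<dots> \<le> 2 ^ length js * (2 * Suc acc)" by (rule mult_le_mono2) simp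
  finally show ?case by (simp add: mult.assoc mult.left_commute)
qed simp

text \<open>A formula cannot select a variable by a computed number. It branches on the memberships
  instead, so that at each leaf \<open>acc\<close> is the cell number and a constant. The offset 2
  leaves room for the constant 0 and the node.\<close>

primrec fBelow :: "nat \<Rightarrow> (nat \<times> nat) list \<Rightarrow> nat \<Rightarrow> nat \<Rightarrow> nat \<Rightarrow> fm" where
  "fBelow m [] acc u v = Less u (2 + acc)" for m
| "fBelow m (j # js) acc u v = (let nb = fNbr m (fst j) (snd j) u v in
    Or (And nb (fBelow m js (2 * acc + 1) u v)) (And (Neg nb) (fBelow m js (2 * acc) u v)))"

lemma eval_fBelow [simp]:
  "env_ok m w \<rho> \<Longrightarrow> u < m \<Longrightarrow> v < m \<Longrightarrow> 2 + 2 ^ length js * Suc acc \<le> m \<Longrightarrow>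
    eval m (fBelow m js acc u v) w \<rho> \<longleftrightarrow> \<rho> u < \<rho> (2 + cell w (\<rho> v) js acc (\<rho> u))"
proof (induction js arbitrary: acc)
  case (Cons j js)
  have "2 + 2 ^ length js * Suc (2 * acc + 1) \<le> m" using Cons.prems(4) by (simp add: algebra_simps)
  moreover have "2 + 2 ^ length js * Suc (2 * acc) \<le> m"
    using calculation by (simp add: algebra_simps)
  ultimately show ?case
    using Cons.IH[OF Cons.prems(1-3), of "2 * acc + 1"] Cons.IH[OF Cons.prems(1-3), of "2 * acc"] Cons.prems(1-3)
    by (simp add: Let_def)
qed simp

text \<open>A layer that does not exist has no symmetry table, so its bit is false and does not contribute to
  the index into the truth table.\<close>

definition Loc :: "nat list \<Rightarrow> (nat \<times> nat) list \<Rightarrow> (nat \<Rightarrow> nat) \<Rightarrow> nat \<Rightarrow> nat \<Rightarrow> nat \<Rightarrow> bool" where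
  "Loc w js \<theta> v s i \<longleftrightarrow> (\<exists>c<length w.
    c = card {u. u < length w \<and> Nbr w s i u v \<and> u < \<theta> (cell w v js 0 u)} \<and> Bit w [Suc s, 1, i, v] c)"

definition fLoc :: "nat \<Rightarrow> (nat \<times> nat) list \<Rightarrow> nat \<Rightarrow> nat \<Rightarrow> nat \<Rightarrow> fm" where
  "fLoc m js v s i = Exists (And
    (Count m (And (fNbr (Suc (Suc m)) s i (Suc m) v) (fBelow (Suc (Suc m)) js 0 (Suc m) v)))
    (fBit (Suc m) [Const (Suc s), Const 1, Const i, Var v] (Var m)))"

lemma eval_fLoc [simp]:
  assumes "env_ok m w \<rho>" "v < m" "2 + 2 ^ length js \<le> m"
  shows "eval m (fLoc m js v s i) w \<rho> \<longleftrightarrow> Loc w js (\<lambda>a. \<rho> (2 + a)) (\<rho> v) s i"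
proof -
  \<comment> \<open>The count and its bound node are the new variables \<open>m\<close> and
    \<open>Suc m\<close>, so binding them leaves the thresholds alone.\<close>
  have "2 + cell w (\<rho> v) js 0 u < m" for u
    using cell_less[of w "\<rho> v" js 0 u] assms(3) by simp
  then have "2 + cell w (\<rho> v) js 0 u \<noteq> m" "2 + cell w (\<rho> v) js 0 u \<noteq> Suc m" for u
    using less_irrefl_nat Suc_n_not_le_n by (metis, metis less_SucI less_irrefl_nat)
  then show ?thesis using assms by (simp add: fLoc_def Loc_def cong: conj_cong)
qed

definition Out :: "nat list \<Rightarrow> (nat \<times> nat) list \<Rightarrow> (nat \<Rightarrow> nat) \<Rightarrow> nat \<Rightarrow> nat \<Rightarrow> nat \<Rightarrow> bool" where
  "Out w js \<theta> K v s \<longleftrightarrow> Bit w [Suc s, 2, v] (\<Sum>i<K. if Loc w js \<theta> v s i then 2 ^ i else 0)"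

text \<open>The device of \<open>fBelow\<close> again: each combination of layer outputs has its own
  leaf, where the index into the truth table is a constant.\<close>

primrec fOut :: "nat \<Rightarrow> (nat \<times> nat) list \<Rightarrow> nat \<Rightarrow> nat \<Rightarrow> nat \<Rightarrow> nat \<Rightarrow> fm" where
  "fOut m js v s 0 acc = fBit m [Const (Suc s), Const 2, Var v] (Const acc)"
| "fOut m js v s (Suc r) acc =
    Or (And (fLoc m js v s r) (fOut m js v s r (acc + 2 ^ r)))
      (And (Neg (fLoc m js v s r)) (fOut m js v s r acc))"

lemma eval_fOut_acc:
  assumes "env_ok m w \<rho>" "v < m" "2 + 2 ^ length js \<le> m"
  shows "eval m (fOut m js v s r acc) w \<rho> \<longleftrightarrow>
    Bit w [Suc s, 2, \<rho> v] (acc + (\<Sum>i<r. if Loc w js (\<lambda>a. \<rho> (2 + a)) (\<rho> v) s i then 2 ^ i else 0))"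
  using assms by (induction r arbitrary: acc) (simp_all add: add_ac)

lemma eval_fOut [simp]:
  assumes "env_ok m w \<rho>" "v < m" "2 + 2 ^ length js \<le> m"
  shows "eval m (fOut m js v s K 0) w \<rho> \<longleftrightarrow> Out w js (\<lambda>a. \<rho> (2 + a)) K (\<rho> v) s"
  by (simp add: eval_fOut_acc[OF assms] Out_def)

primrec Exists_block :: "nat \<Rightarrow> fm \<Rightarrow> fm" where
  "Exists_block 0 \<phi> = \<phi>"
| "Exists_block (Suc N) \<phi> = Exists (Exists_block N \<phi>)"

definition env_block :: "nat \<Rightarrow> nat \<Rightarrow> (nat \<Rightarrow> nat) \<Rightarrow> (nat \<Rightarrow> nat) \<Rightarrow> nat \<Rightarrow> nat" where
  "env_block m N \<theta> \<rho> j = (if m \<le> j \<and> j < m + N then \<theta> (j - m) else \<rho> j)"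

lemma eval_Exists_block:
  "env_ok m w \<rho> \<Longrightarrow> eval m (Exists_block N \<phi>) w \<rho> \<longleftrightarrow>
    (\<exists>\<theta>. (\<forall>a<N. \<theta> a < length w) \<and> eval (m + N) \<phi> w (env_block m N \<theta> \<rho>))"
proof (induction N arbitrary: m \<rho>)
  case 0
  have "env_block m 0 \<theta> \<rho> = \<rho>" for \<theta> by (auto simp: env_block_def)
  then show ?case by simp
next
  case (Suc N)
  have "eval m (Exists_block (Suc N) \<phi>) w \<rho> \<longleftrightarrow> (\<exists>x<length w. \<exists>\<theta>. (\<forall>a<N. \<theta> a < length w) \<and>
      eval (m + Suc N) \<phi> w (env_block (Suc m) N \<theta> (\<rho>(m := x))))"
  proof -
    have "eval (Suc m) (Exists_block N \<phi>) w (\<rho>(m := x)) \<longleftrightarrow> (\<exists>\<theta>. (\<forall>a<N. \<theta> a < length w) \<and>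
        eval (m + Suc N) \<phi> w (env_block (Suc m) N \<theta> (\<rho>(m := x))))" for x
      using Suc.IH[of "Suc m" "\<rho>(m := x)"] Suc.prems by (simp del: fun_upd_apply)
    then show ?thesis using Suc.prems by simp
  qed
  also have "\<dots> \<longleftrightarrow> (\<exists>\<theta>. (\<forall>a<Suc N. \<theta> a < length w) \<and> eval (m + Suc N) \<phi> w (env_block m (Suc N) \<theta> \<rho>))"
  proof
    assume "\<exists>x<length w. \<exists>\<theta>. (\<forall>a<N. \<theta> a < length w) \<and>
      eval (m + Suc N) \<phi> w (env_block (Suc m) N \<theta> (\<rho>(m := x)))"
    then obtain x \<theta> where *: "x < length w" "\<forall>a<N. \<theta> a < length w"
      "eval (m + Suc N) \<phi> w (env_block (Suc m) N \<theta> (\<rho>(m := x)))" by blast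
    \<comment> \<open>The outermost value becomes entry 0 of the block and the others move up by
      one.\<close>
    have "env_block (Suc m) N \<theta> (\<rho>(m := x)) = env_block m (Suc N) (case_nat x \<theta>) \<rho>"
    proof
      fix j
      show "env_block (Suc m) N \<theta> (\<rho>(m := x)) j = env_block m (Suc N) (case_nat x \<theta>) \<rho> j"
        by (cases "j - m") (auto simp: env_block_def diff_Suc)
    qed
    moreover have "\<forall>a<Suc N. case_nat x \<theta> a < length w" using * by (simp split: nat.split)
    ultimately show "\<exists>\<theta>. (\<forall>a<Suc N. \<theta> a < length w) \<and> eval (m + Suc N) \<phi> w (env_block m (Suc N) \<theta> \<rho>)"
      using *(3) by metis
  next
    assume "\<exists>\<theta>. (\<forall>a<Suc N. \<theta> a < length w) \<and> eval (m + Suc N) \<phi> w (env_block m (Suc N) \<theta> \<rho>)"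
    then obtain \<theta> where *: "\<forall>a<Suc N. \<theta> a < length w" "eval (m + Suc N) \<phi> w (env_block m (Suc N) \<theta> \<rho>)"
      by blast
    have "env_block m (Suc N) \<theta> \<rho> = env_block (Suc m) N (\<lambda>a. \<theta> (Suc a)) (\<rho>(m := \<theta> 0))"
    proof
      fix j
      show "env_block m (Suc N) \<theta> \<rho> j = env_block (Suc m) N (\<lambda>a. \<theta> (Suc a)) (\<rho>(m := \<theta> 0)) j"
        by (auto simp: env_block_def Suc_diff_Suc)
    qed
    with * show "\<exists>x<length w. \<exists>\<theta>. (\<forall>a<N. \<theta> a < length w) \<and>
      eval (m + Suc N) \<phi> w (env_block (Suc m) N \<theta> (\<rho>(m := x)))"
      by (intro exI[of _ "\<theta> 0"] conjI exI[of _ "\<lambda>a. \<theta> (Suc a)"]) auto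
  qed
  finally show ?case .
qed

text \<open>Equivalence is expressed as the absence of a distinguishing node, variable 1, and
  thresholds, variables 2 to \<open>N + 1\<close>. Both range over all positions of the word, also
  beyond the number of nodes; such values cause no false alarm.\<close>

definition fEquiv :: "nat \<Rightarrow> (nat \<times> nat) list \<Rightarrow> fm" where
  "fEquiv K js = (let N = 2 ^ length js; out = (\<lambda>s. fOut (2 + N) js 1 s K 0) in
    Neg (Exists (Exists_block N (Or (And (out 0) (Neg (out 1))) (And (Neg (out 0)) (out 1))))))"

lemma eval_fEquiv:
  assumes "w \<noteq> []"
  shows "eval 1 (fEquiv K js) w (\<lambda>_. 0) \<longleftrightarrow>
    (\<forall>v<length w. \<forall>\<theta>. (\<forall>a<2 ^ length js. \<theta> a < length w) \<longrightarrow> Out w js \<theta> K v 0 = Out w js \<theta> K v 1)"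
proof -
  define N :: nat where "N = 2 ^ length js"
  have ok: "env_ok 1 w (\<lambda>_. 0)" using assms by (simp add: env_ok_def)
  have ok2: "env_ok 2 w ((\<lambda>_. 0)(1 := v))" for v using env_ok_upd[OF ok] by (simp add: numeral_2_eq_2)
  have out: "eval (2 + N) (fOut (2 + N) js 1 s K 0) w (env_block 2 N \<theta> ((\<lambda>_. 0)(1 := v))) \<longleftrightarrow>
      Out w js \<theta> K v s" for v \<theta> s
  proof -
    let ?\<rho> = "env_block 2 N \<theta> ((\<lambda>_. 0)(1 := v))"
    have "env_ok (2 + N) w ?\<rho>" using assms by (simp add: env_ok_def env_block_def)
    then have "eval (2 + N) (fOut (2 + N) js 1 s K 0) w ?\<rho> \<longleftrightarrow> Out w js (\<lambda>a. ?\<rho> (2 + a)) K v s"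
      by (simp add: N_def env_block_def)
    moreover have "?\<rho> (2 + cell w v js 0 u) = \<theta> (cell w v js 0 u)" for u
      using cell_less[of w v js 0 u] by (simp add: env_block_def N_def)
    ultimately show ?thesis by (simp add: Out_def Loc_def)
  qed
  have "eval 1 (fEquiv K js) w (\<lambda>_. 0) \<longleftrightarrow> \<not> (\<exists>v<length w. eval 2
      (Exists_block N (Or (And (fOut (2 + N) js 1 0 K 0) (Neg (fOut (2 + N) js 1 1 K 0)))
        (And (Neg (fOut (2 + N) js 1 0 K 0)) (fOut (2 + N) js 1 1 K 0)))) w ((\<lambda>_. 0)(1 := v)))"
    by (simp only: fEquiv_def Let_def N_def[symmetric] eval.simps eval_Exists[OF ok] Suc_1)
  also have "\<dots> \<longleftrightarrow> (\<forall>v<length w. \<forall>\<theta>. (\<forall>a<N. \<theta> a < length w) \<longrightarrow> Out w js \<theta> K v 0 = Out w js \<theta> K v 1)"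
    unfolding eval_Exists_block[OF ok2] eval_Or eval.simps out by blast
  finally show ?thesis by (simp add: N_def)
qed

section \<open>Configurations given by thresholds\<close>

text \<open>A discrete intermediate value argument: raising the threshold by one raises the count by
  at most one.\<close>

lemma ex_threshold: "c \<le> card {u. u < n \<and> P u} \<Longrightarrow> \<exists>t\<le>n. card {u. u < t \<and> P (u::nat)} = c"
proof (induction n)
  case (Suc n)
  have "{u. u < Suc n \<and> P u} = {u. u < n \<and> P u} \<union> (if P n then {n} else {})"
    by (auto simp: less_Suc_eq)
  then have "card {u. u < Suc n \<and> P u} = card {u. u < n \<and> P u} + (if P n then 1 else 0)"
    by simp
  then consider "c \<le> card {u. u < n \<and> P u}" | "c = card {u. u < Suc n \<and> P u}"
    using Suc.prems by (cases "P n") (auto simp: le_Suc_eq)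
  then show ?case
  proof cases
    case 1
    then show ?thesis using Suc.IH le_SucI by blast
  qed auto
qed simp

lemma card_by_fibres:
  assumes "finite N"
  shows "card {u \<in> N. Q u} = (\<Sum>a\<in>f ` N. card {u \<in> N. f u = a \<and> Q u})"
proof -
  have "card {u \<in> N. Q u} = (\<Sum>u\<in>N. of_bool (Q u))"
    using assms by (simp add: sum_of_bool_eq Int_def)
  also have "\<dots> = (\<Sum>a\<in>f ` N. \<Sum>u\<in>{u \<in> N. f u = a}. of_bool (Q u))"
    using assms by (rule sum.image_gen)
  also have "\<dots> = (\<Sum>a\<in>f ` N. card {u \<in> N. f u = a \<and> Q u})"
    using assms by (simp add: sum_of_bool_eq Int_def conj_assoc)
  finally show ?thesis .
qed

text \<open>Each fibre gets the threshold that reproduces its own number of ones. The choice does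
  not depend on \<open>N\<close>, so one \<open>\<theta>\<close> serves all unions of fibres at
  once, in particular the neighbourhoods of a node in all layers of both systems.\<close>

lemma ex_thresholds:
  fixes f :: "nat \<Rightarrow> nat" and C :: "nat \<Rightarrow> bool"
  obtains \<theta> where "\<And>a. \<theta> a \<le> n"
    "\<And>N. N \<subseteq> {..<n} \<Longrightarrow> (\<And>u u'. u \<in> N \<Longrightarrow> u' < n \<Longrightarrow> f u = f u' \<Longrightarrow> u' \<in> N) \<Longrightarrow>
      card {u \<in> N. u < \<theta> (f u)} = card {u \<in> N. C u}"
proof -
  have "\<exists>t\<le>n. card {u. u < t \<and> f u = a} = card {u. u < n \<and> f u = a \<and> C u}" for a
    by (rule ex_threshold) (auto intro: card_mono)
  then obtain \<theta> where \<theta>: "\<And>a. \<theta> a \<le> n"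
    "\<And>a. card {u. u < \<theta> a \<and> f u = a} = card {u. u < n \<and> f u = a \<and> C u}" by metis
  have "card {u \<in> N. u < \<theta> (f u)} = card {u \<in> N. C u}"
    if N: "N \<subseteq> {..<n}" "\<And>u u'. u \<in> N \<Longrightarrow> u' < n \<Longrightarrow> f u = f u' \<Longrightarrow> u' \<in> N" for N
  proof -
    have fin: "finite N" using N(1) finite_subset by blast
    have "card {u \<in> N. f u = a \<and> u < \<theta> (f u)} = card {u \<in> N. f u = a \<and> C u}" if "a \<in> f ` N" for a
    proof -
      have fibre: "u \<in> N \<and> f u = a \<longleftrightarrow> u < n \<and> f u = a" for u
        using that N by auto
      have "{u \<in> N. f u = a \<and> u < \<theta> (f u)} = {u. u < \<theta> a \<and> f u = a}"
        using fibre \<theta>(1)[of a] by (auto dest: less_le_trans)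
      moreover have "{u \<in> N. f u = a \<and> C u} = {u. u < n \<and> f u = a \<and> C u}"
        using fibre by auto
      ultimately show ?thesis using \<theta>(2)[of a] by simp
    qed
    then show ?thesis
      unfolding card_by_fibres[OF fin, of "\<lambda>u. u < \<theta> (f u)" f] card_by_fibres[OF fin, of C f]
      by (rule sum.cong[OF refl])
  qed
  with \<theta>(1) that show thesis by blast
qed

text \<open>Equal numbers have equal binary digits: the induction hypothesis strips the digits of
  \<open>js\<close>, then \<open>div 2\<close> and \<open>mod 2\<close> recover the digit of
  \<open>j\<close>.\<close>

lemma cell_eqD:
  "cell w v js acc u = cell w v js acc' u' \<Longrightarrow>
    acc = acc' \<and> (\<forall>j\<in>set js. Nbr w (fst j) (snd j) u v = Nbr w (fst j) (snd j) u' v)"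
proof (induction js arbitrary: acc acc')
  case (Cons j js)
  let ?b = "\<lambda>u. if Nbr w (fst j) (snd j) u v then 1 else 0 :: nat"
  note IH = Cons.IH[OF Cons.prems[unfolded cell.simps]]
  have "2 * acc + ?b u = 2 * acc' + ?b u'" using IH by (rule conjunct1)
  then have "(2 * acc + ?b u) div 2 = (2 * acc' + ?b u') div 2"
    "(2 * acc + ?b u) mod 2 = (2 * acc' + ?b u') mod 2" by simp_all
  then have "acc = acc'" "Nbr w (fst j) (snd j) u v = Nbr w (fst j) (snd j) u' v"
    by (auto split: if_splits)
  with IH show ?case by simp
qed simp

section \<open>The instance as a tree, and the meaning of the sentence on it\<close>

definition sys_tree :: "msyds \<Rightarrow> tree" where
  "sys_tree S = Node [Node (map edges_tree (layers S)),
    Node (map (\<lambda>tv. Node (map bits_tree tv)) (symtabs S)), Node (map bits_tree (masters S))]"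

definition instance_trees :: "nat \<Rightarrow> msyds \<Rightarrow> msyds \<Rightarrow> tree list" where
  "instance_trees n S0 S1 = [Leaf (replicate n 1), sys_tree S0, sys_tree S1]"

lemma enc_bits_tree: "enc (bits_tree bs) = enc_bools bs"
  by (simp add: bits_tree_def enc_bools_def comp_def)

lemma enc_edges_tree: "enc (edges_tree es) = enc_seq (map enc_edge es)"
  by (simp add: edges_tree_def enc_edge_def[abs_def] enc_nat_def comp_def)

lemma enc_instance_tree: "enc_instance n S0 S1 = enc (Node (instance_trees n S0 S1))"
  by (simp add: enc_instance_def enc_msyds_def instance_trees_def sys_tree_def enc_nat_def comp_def
      enc_bits_tree enc_edges_tree)

lemma bits_only_bits_tree: "bits_only (bits_tree bs)"
  by (simp add: bits_tree_def)

lemma bits_only_edges_tree: "bits_only (edges_tree es)"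
  by (auto simp: edges_tree_def)

lemma bits_only_instance: "bits_only (Node (instance_trees n S0 S1))"
  by (auto simp: instance_trees_def sys_tree_def bits_only_bits_tree bits_only_edges_tree)

context
  fixes n K :: nat and S :: "nat \<Rightarrow> msyds" and w :: "nat list" and js :: "(nat \<times> nat) list"
  assumes valid: "s < 2 \<Longrightarrow> valid_msyds n K (S s)"
    and w: "w = enc_instance n (S 0) (S 1)"
    and js: "set js = {..<2} \<times> {..<K}"
begin

lemma w_tree: "w = enc (Node (instance_trees n (S 0) (S 1)))"
  by (simp add: w enc_instance_tree)

text \<open>The unary \<open>n\<close> makes all nodes, thresholds up to \<open>n\<close> and
  numbers of ones positions of the word.\<close>

lemma less_length_w: "n < length w"
  by (simp add: w enc_instance_def enc_seq_def enc_nat_def)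

lemma num_layers:
  "s < 2 \<Longrightarrow> length (layers (S s)) \<le> K"
  "s < 2 \<Longrightarrow> length (symtabs (S s)) = length (layers (S s))"
  "s < 2 \<Longrightarrow> length (masters (S s)) = n"
  "s < 2 \<Longrightarrow> i < length (layers (S s)) \<Longrightarrow> length (symtabs (S s) ! i) = n"
  "s < 2 \<Longrightarrow> i < length (layers (S s)) \<Longrightarrow> v < n \<Longrightarrow>
    length (symtabs (S s) ! i ! v) = Suc (card (closed_nbhd (layers (S s) ! i) v))"
  "s < 2 \<Longrightarrow> v < n \<Longrightarrow> length (masters (S s) ! v) = 2 ^ length (layers (S s))"
  using valid[of s] by (auto simp: valid_msyds_def Let_def)

lemma closed_nbhd_subset:
  assumes "s < 2" "i < length (layers (S s))" "v < n"
  shows "closed_nbhd (layers (S s) ! i) v \<subseteq> {..<n}"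
proof -
  have "layers (S s) ! i \<in> set (layers (S s))" using assms(2) by simp
  then show ?thesis
    using valid[OF assms(1)] assms(3) by (fastforce simp: valid_msyds_def Let_def closed_nbhd_def nbrs_def)
qed

lemma subtree_sys: "s < 2 \<Longrightarrow> subtree (Node (instance_trees n (S 0) (S 1))) (Suc s # is) = subtree (sys_tree (S s)) is"
  by (auto simp: instance_trees_def less_2_cases_iff)

lemma Edge_layer:
  assumes "s < 2"
  shows "Edge w [Suc s, 0, i] a b \<longleftrightarrow> i < length (layers (S s)) \<and> (a, b) \<in> set (layers (S s) ! i)"
proof (cases "i < length (layers (S s))")
  case True
  then have "subtree (Node (instance_trees n (S 0) (S 1))) [Suc s, 0, i] = Some (edges_tree (layers (S s) ! i))"
    unfolding subtree_sys[OF assms] by (simp add: sys_tree_def)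
  from Edge_iff[OF w_tree bits_only_instance this] True show ?thesis by simp
next
  case False
  then have "subtree (Node (instance_trees n (S 0) (S 1))) [Suc s, 0, i] = None"
    unfolding subtree_sys[OF assms] by (simp add: sys_tree_def)
  from not_Edge[OF w_tree bits_only_instance this] False show ?thesis by simp
qed

lemma Bit_symtab:
  assumes "s < 2"
  shows "Bit w [Suc s, 1, i, v] c \<longleftrightarrow> i < length (symtabs (S s)) \<and> v < length (symtabs (S s) ! i)
    \<and> c < length (symtabs (S s) ! i ! v) \<and> symtabs (S s) ! i ! v ! c"
proof (cases "i < length (symtabs (S s)) \<and> v < length (symtabs (S s) ! i)")
  case True
  then have "subtree (Node (instance_trees n (S 0) (S 1))) [Suc s, 1, i, v] = Some (bits_tree (symtabs (S s) ! i ! v))"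
    unfolding subtree_sys[OF assms] by (simp add: sys_tree_def)
  from Bit_iff[OF w_tree bits_only_instance this] True show ?thesis by simp
next
  case False
  then have "subtree (Node (instance_trees n (S 0) (S 1))) [Suc s, 1, i, v] = None"
    unfolding subtree_sys[OF assms] by (auto simp: sys_tree_def)
  from not_Bit[OF w_tree bits_only_instance this] False show ?thesis by auto
qed

lemma Bit_master:
  assumes "s < 2"
  shows "Bit w [Suc s, 2, v] c \<longleftrightarrow> v < length (masters (S s))
    \<and> c < length (masters (S s) ! v) \<and> masters (S s) ! v ! c"
proof (cases "v < length (masters (S s))")
  case True
  then have "subtree (Node (instance_trees n (S 0) (S 1))) [Suc s, 2, v] = Some (bits_tree (masters (S s) ! v))"
    unfolding subtree_sys[OF assms] by (simp add: sys_tree_def)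
  from Bit_iff[OF w_tree bits_only_instance this] True show ?thesis by simp
next
  case False
  then have "subtree (Node (instance_trees n (S 0) (S 1))) [Suc s, 2, v] = None"
    unfolding subtree_sys[OF assms] by (simp add: sys_tree_def)
  from not_Bit[OF w_tree bits_only_instance this] False show ?thesis by simp
qed

lemma Nbr_iff:
  "s < 2 \<Longrightarrow> i < length (layers (S s)) \<Longrightarrow> Nbr w s i u v \<longleftrightarrow> u \<in> closed_nbhd (layers (S s) ! i) v"
  by (simp add: Nbr_def Edge_layer closed_nbhd_def nbrs_def)

text \<open>Only the counts have to agree, \<open>C\<close> need not be the threshold configuration
  itself. This form serves both directions of the equivalence.\<close>

lemma Out_iff:
  assumes s: "s < 2" and v: "v < n"
    and counts: "\<And>i. i < length (layers (S s)) \<Longrightarrow>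
      card {u \<in> closed_nbhd (layers (S s) ! i) v. u < \<theta> (cell w v js 0 u)}
      = card {u \<in> closed_nbhd (layers (S s) ! i) v. C u}"
  shows "Out w js \<theta> K v s \<longleftrightarrow> successor n (S s) C v"
proof -
  let ?k = "length (layers (S s))"
  have loc: "Loc w js \<theta> v s i \<longleftrightarrow> i < ?k \<and> local_val (S s) i v C" for i
  proof (cases "i < ?k")
    case True
    let ?N = "closed_nbhd (layers (S s) ! i) v"
    have N: "?N \<subseteq> {..<n}" using closed_nbhd_subset[OF s True v] .
    have "{u. u < length w \<and> Nbr w s i u v \<and> u < \<theta> (cell w v js 0 u)}
        = {u \<in> ?N. u < \<theta> (cell w v js 0 u)}"
      using N less_length_w by (auto simp: Nbr_iff[OF s True])
    moreover have fin: "finite ?N" using N finite_subset by blast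
    \<comment> \<open>This bound puts the count inside the symmetry table; the next one puts it
      inside the range of the quantifier in \<open>Loc\<close>.\<close>
    moreover have "card {u \<in> ?N. C u} \<le> card ?N" using fin by (intro card_mono) auto
    moreover have "card ?N \<le> n" using card_mono[OF _ N] by simp
    ultimately show ?thesis
      unfolding Loc_def Bit_symtab[OF s] local_val_def
      using True v less_length_w counts[OF True] num_layers(2,4,5)[OF s] by auto
  next
    case False
    then show ?thesis unfolding Loc_def Bit_symtab[OF s] using num_layers(2)[OF s] by simp
  qed
  let ?idx = "\<Sum>i<?k. if local_val (S s) i v C then 2 ^ i else 0 :: nat"
  \<comment> \<open>Absent layers contribute 0, so the sum up to \<open>K\<close> is the index
    formed from the actual layers.\<close>
  have "(\<Sum>i<K. if Loc w js \<theta> v s i then 2 ^ i else 0) = ?idx"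
    using num_layers(1)[OF s] by (intro sum.mono_neutral_cong_right) (auto simp: loc)
  moreover have "?idx < 2 ^ ?k"
  proof -
    have "?idx \<le> (\<Sum>i<?k. 2 ^ i)" by (rule sum_mono) simp
    also have "\<dots> < 2 ^ ?k" by (rule sum_powers_of_two_less)
    finally show ?thesis .
  qed
  ultimately show ?thesis
    using v num_layers(3,6)[OF s] by (simp add: Out_def Bit_master[OF s] successor_def master_val_def)
qed

lemma eval_fEquiv_instance: "eval 1 (fEquiv K js) w (\<lambda>_. 0) \<longleftrightarrow> equivalent n (S 0) (S 1)"
proof -
  have "w \<noteq> []" using less_length_w by auto
  have "(\<forall>v<length w. \<forall>\<theta>. (\<forall>a<2 ^ length js. \<theta> a < length w) \<longrightarrow> Out w js \<theta> K v 0 = Out w js \<theta> K v 1)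
    \<longleftrightarrow> (\<forall>C\<in>configs n. successor n (S 0) C = successor n (S 1) C)" (is "?L \<longleftrightarrow> ?R")
  proof
    assume L: ?L
    show ?R
    proof (intro ballI ext)
      fix C v
      show "successor n (S 0) C v = successor n (S 1) C v"
      proof (cases "v < n")
        case True
        \<comment> \<open>Cells are relative to \<open>v\<close>, so the thresholds depend on
          \<open>v\<close> and \<open>C\<close>, but they are common to both systems.\<close>
        obtain \<theta> where \<theta>: "\<And>a. \<theta> a \<le> n"
          "\<And>N. N \<subseteq> {..<n} \<Longrightarrow> (\<And>u u'. u \<in> N \<Longrightarrow> u' < n \<Longrightarrow> cell w v js 0 u = cell w v js 0 u' \<Longrightarrow> u' \<in> N) \<Longrightarrow>
            card {u \<in> N. u < \<theta> (cell w v js 0 u)} = card {u \<in> N. C u}"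
          using ex_thresholds[of n "cell w v js 0" C] by blast
        have out: "Out w js \<theta> K v s \<longleftrightarrow> successor n (S s) C v" if s: "s < 2" for s
        proof (rule Out_iff[OF s True], rule \<theta>(2))
          fix i assume i: "i < length (layers (S s))"
          show "closed_nbhd (layers (S s) ! i) v \<subseteq> {..<n}" using closed_nbhd_subset[OF s i True] .
          fix u u' assume "u \<in> closed_nbhd (layers (S s) ! i) v" "cell w v js 0 u = cell w v js 0 u'"
          \<comment> \<open>Every layer of either system has its digit in the cell number, so its
            neighbourhood is a union of cells; pairs of absent layers merely refine them.\<close>
          moreover have "(s, i) \<in> set js" using js s i num_layers(1)[OF s] by auto
          ultimately show "u' \<in> closed_nbhd (layers (S s) ! i) v"
            using cell_eqD[of w v js 0 u 0 u'] by (force simp flip: Nbr_iff[OF s i])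
        qed
        have "\<theta> a < length w" for a using \<theta>(1)[of a] less_length_w by simp
        then have "Out w js \<theta> K v 0 = Out w js \<theta> K v 1" using L True less_length_w by simp
        then show ?thesis using out by simp
      qed (simp add: successor_def)
    qed
  next
    assume R: ?R
    show ?L
    proof (intro allI impI)
      fix v \<theta>
      \<comment> \<open>Thresholds above \<open>n\<close> act like \<open>n\<close>: the cut at
        \<open>u < n\<close> makes \<open>C\<close> a configuration and changes nothing within the
        neighbourhoods.\<close>
      define C where "C u \<longleftrightarrow> u < n \<and> u < \<theta> (cell w v js 0 u)" for u
      have "C \<in> configs n" by (auto simp: configs_def C_def)
      show "Out w js \<theta> K v 0 = Out w js \<theta> K v 1"
      proof (cases "v < n")
        case True
        have "Out w js \<theta> K v s \<longleftrightarrow> successor n (S s) C v" if s: "s < 2" for s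
        proof (rule Out_iff[OF s True])
          fix i assume i: "i < length (layers (S s))"
          show "card {u \<in> closed_nbhd (layers (S s) ! i) v. u < \<theta> (cell w v js 0 u)}
            = card {u \<in> closed_nbhd (layers (S s) ! i) v. C u}"
            using closed_nbhd_subset[OF s i True] by (intro arg_cong[where f = card]) (auto simp: C_def)
        qed
        then show ?thesis using R \<open>C \<in> configs n\<close> by simp
      next
        case False
        \<comment> \<open>A position that is no node has no master table, so both outputs are
          false.\<close>
        then show ?thesis using num_layers(3) by (simp add: Out_def Bit_master)
      qed
    qed
  qed
  also have "\<dots> \<longleftrightarrow> equivalent n (S 0) (S 1)"
    unfolding equivalent_def phase_space_def by auto
  finally show ?thesis unfolding eval_fEquiv[OF \<open>w \<noteq> []\<close>] .
qed

end

theorem theorem5p1: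
  fixes K :: nat
  assumes "1 \<le> K"
  shows "\<exists>M c d. tm_wf M \<and>
    (\<forall>n S0 S1. valid_msyds n K S0 \<and> valid_msyds n K S1 \<longrightarrow>
       (\<exists>t \<le> c * length (enc_instance n S0 S1) ^ d + c.
          tm_decides_within M (enc_instance n S0 S1) (equivalent n S0 S1) t))"
proof -
  \<comment> \<open>This list has length \<open>2 * K\<close>, which gives \<open>4 ^ K\<close>
    cells. It depends on \<open>K\<close> alone, so the sentence and the machine are fixed before
    any instance.\<close>
  define js where "js = List.product [0..<2] [0..<K]"
  obtain M c d where M: "tm_wf M"
    and run: "\<And>w. set w \<subseteq> {..<5} \<Longrightarrow>
      \<exists>t \<le> c * length w ^ d + c. tm_decides_within M w (eval 1 (fEquiv K js) w (\<lambda>_. 0)) t"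
    using fm_decidable_in_polynomial_time[of "fEquiv K js"] by blast
  have "\<exists>t \<le> c * length (enc_instance n S0 S1) ^ d + c.
      tm_decides_within M (enc_instance n S0 S1) (equivalent n S0 S1) t"
    if valid: "valid_msyds n K S0" "valid_msyds n K S1" for n S0 S1
  proof -
    define S where "S s = (if s = 0 then S0 else S1)" for s :: nat
    have "eval 1 (fEquiv K js) (enc_instance n S0 S1) (\<lambda>_. 0) \<longleftrightarrow> equivalent n (S 0) (S 1)"
      using valid by (intro eval_fEquiv_instance) (auto simp: S_def js_def)
    moreover have "set (enc_instance n S0 S1) \<subseteq> {..<5}"
      unfolding enc_instance_tree by (rule set_enc[OF bits_only_instance])
    ultimately show ?thesis using run[of "enc_instance n S0 S1"] by (simp add: S_def)
  qed
  with M show ?thesis by blast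
qed

end
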